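(* Let $Q$ be an affine monoid and $\mathbb{K}$ a field. If $Q$ has an $i$-*dimensional family of holes, then the *depth of $\mathbb{K}[Q]$ is at most $i+1$.
   Context: An affine monoid $Q$ is a finitely generated submonoid of $\mathbb{Z}^N$ for some $N\in\mathbb{N}$; $\mathbb{Z}Q$ is the group generated by $Q$, $\mathbb{R}_+Q$ the convex cone generated by $Q$, $\overline{Q}=\mathbb{Z}Q\cap\mathbb{R}_+Q$ the normalization. A face of $Q$ is a nonempty subset $F\subseteq Q$ such that for $a,b\in Q$: $a+b\in F\Leftrightarrow a,b\in F$. $F_0$ denotes the unique minimal face (the invertible elements of $Q$). The *dimension of a face $F$ is $\operatorname{rank}\mathbb{Z}F-\operatorname{rank}\mathbb{Z}F_0$. $\mathbb{K}[Q]$ is the monoid algebra, $\mathfrak{m}$ its maximal graded ideal with respect to the $\mathbb{Z}Q$-grading (spanned by monomials $\mathbf{x}^q$, $q\in Q\setminus F_0$), and the *depth of $\mathbb{K}[Q]$ is the maximal length of a regular sequence in $\mathfrak{m}$ (equivalently, the depth of the localization $\mathbb{K}[Q]_{\mathfrak{m}}$). Families of holes: the set $\overline{Q}\setminus Q$ can be written as an irredundant finite union $\bigcup_i (q_i+\mathbb{Z}F_i)\cap\overline{Q}$ with $q_i\in\overline{Q}$ and faces $F_i$ of $Q$, and the collection of sets $q_i+\mathbb{Z}F_i$ is uniquely determined by $Q$. Each set $q_i+\mathbb{Z}F_i$ occurring is called a family of holes of $Q$, and its *dimension is the *dimension of $F_i$. *)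

theory Defs
  imports
    "HOL-Analysis.Analysis"
    "HOL-Library.Poly_Mapping"
    "HOL-Library.Extended_Nat"
    "HOL-Computational_Algebra.Group_Closure"
    "HOL-Algebra.Ideal"
begin

section \<open>Affine monoids and their faces\<close>

definition add_submonoid :: "'a::comm_monoid_add set \<Rightarrow> bool"
  where "add_submonoid M \<longleftrightarrow> 0 \<in> M \<and> (\<forall>a\<in>M. \<forall>b\<in>M. a + b \<in> M)"

text \<open>The ambient lattice \<open>\<int>\<^sup>N\<close> is \<open>int ^ 'n\<close>. The group generated by \<open>Q\<close> is
  \<^const>\<open>group_closure\<close>.\<close>

definition affine_monoid :: "(int ^ 'n) set \<Rightarrow> bool"
  where "affine_monoid Q \<longleftrightarrow> (\<exists>S. finite S \<and> Q = add_submonoid hull S)"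

lemma add_submonoid_hull: "add_submonoid (add_submonoid hull S)"
  by (rule hull_in) (auto simp: add_submonoid_def)

lemma affine_monoid_imp_add_submonoid: "affine_monoid Q \<Longrightarrow> add_submonoid Q"
  by (auto simp: affine_monoid_def add_submonoid_hull)

definition real_vec :: "int ^ 'n \<Rightarrow> real ^ 'n"
  where "real_vec x = (\<chi> i. real_of_int (x $ i))"

definition normalization :: "(int ^ 'n) set \<Rightarrow> (int ^ 'n) set"
  where "normalization Q = {x \<in> group_closure Q. real_vec x \<in> convex_cone hull (real_vec ` Q)}"

definition monoid_face :: "'a::comm_monoid_add set \<Rightarrow> 'a set \<Rightarrow> bool"
  where "monoid_face Q F \<longleftrightarrow>
    F \<noteq> {} \<and> F \<subseteq> Q \<and> (\<forall>a\<in>Q. \<forall>b\<in>Q. a + b \<in> F \<longleftrightarrow> a \<in> F \<and> b \<in> F)"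

definition minimal_face :: "'a::ab_group_add set \<Rightarrow> 'a set"
  where "minimal_face Q = {q \<in> Q. - q \<in> Q}"

lemma monoid_face_minimal_face:
  assumes "add_submonoid Q"
  shows "monoid_face Q (minimal_face Q)"
proof -
  have Q: "0 \<in> Q" "\<And>a b. a \<in> Q \<Longrightarrow> b \<in> Q \<Longrightarrow> a + b \<in> Q"
    using assms by (auto simp: add_submonoid_def)
  have inv: "- a \<in> Q" if "a \<in> Q" "b \<in> Q" "- (a + b) \<in> Q" for a b
    using Q(2)[OF that(3,2)] by simp
  have "a + b \<in> minimal_face Q \<longleftrightarrow> a \<in> minimal_face Q \<and> b \<in> minimal_face Q"
    if "a \<in> Q" "b \<in> Q" for a b
  proof
    assume "a + b \<in> minimal_face Q"
    then have "- (a + b) \<in> Q" "- (b + a) \<in> Q"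
      by (simp_all add: minimal_face_def add.commute)
    then show "a \<in> minimal_face Q \<and> b \<in> minimal_face Q"
      using inv[of a b] inv[of b a] that by (simp add: minimal_face_def)
  next
    assume "a \<in> minimal_face Q \<and> b \<in> minimal_face Q"
    then show "a + b \<in> minimal_face Q"
      using Q(2)[of a b] Q(2)[of "- a" "- b"] by (simp add: minimal_face_def)
  qed
  moreover have "0 \<in> minimal_face Q" using Q(1) by (simp add: minimal_face_def)
  ultimately show ?thesis
    by (auto simp: monoid_face_def minimal_face_def)
qed

lemma minimal_face_subset:
  assumes "add_submonoid Q" "monoid_face Q F"
  shows "minimal_face Q \<subseteq> F"
proof
  fix q assume "q \<in> minimal_face Q"
  then have q: "q \<in> Q" "- q \<in> Q" by (auto simp: minimal_face_def)
  obtain f where f: "f \<in> F" "f \<in> Q" using assms(2) by (auto simp: monoid_face_def)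
  have "0 \<in> Q" using assms(1) by (simp add: add_submonoid_def)
  then have "0 \<in> F" using f assms(2) unfolding monoid_face_def by (metis add.right_neutral)
  then show "q \<in> F" using q assms(2) unfolding monoid_face_def by (metis add.right_inverse)
qed


section \<open>Rank and *dimension\<close>

global_interpretation int_vec: module "(*s) :: int \<Rightarrow> int ^ 'n \<Rightarrow> int ^ 'n"
  by unfold_locales (vector algebra_simps)+

definition group_rank :: "(int ^ 'n) set \<Rightarrow> nat"
  where "group_rank G =
    (GREATEST r. \<exists>B. B \<subseteq> G \<and> finite B \<and> card B = r \<and> int_vec.independent B)"

text \<open>Subtraction on \<^typ>\<open>nat\<close> does not truncate here, since \<^const>\<open>minimal_face\<close> is contained
  in every face.\<close>

definition star_dim :: "(int ^ 'n) set \<Rightarrow> (int ^ 'n) set \<Rightarrow> nat"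
  where "star_dim Q F = group_rank (group_closure F) - group_rank (group_closure (minimal_face Q))"


section \<open>Families of holes\<close>

definition face_coset :: "'a::ab_group_add \<Rightarrow> 'a set \<Rightarrow> 'a set"
  where "face_coset q F = (+) q ` group_closure F"

text \<open>\<open>D\<close> is the collection of the sets \<open>q\<^sub>i + \<int>F\<^sub>i\<close>; the last conjunct says that none of
  them can be omitted from the union.\<close>

definition hole_decomposition :: "(int ^ 'n) set \<Rightarrow> (int ^ 'n) set set \<Rightarrow> bool"
  where "hole_decomposition Q D \<longleftrightarrow>
    finite D \<and>
    (\<forall>H\<in>D. \<exists>q\<in>normalization Q. \<exists>F. monoid_face Q F \<and> H = face_coset q F) \<and>
    (\<Union>H\<in>D. H \<inter> normalization Q) = normalization Q - Q \<and>
    (\<forall>H\<in>D. (\<Union>H'\<in>D - {H}. H' \<inter> normalization Q) \<noteq> normalization Q - Q)"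

text \<open>There is exactly one such \<open>D\<close>; this need not be known here, as the families of holes are
  the members of any such \<open>D\<close>.\<close>

definition family_of_holes :: "(int ^ 'n) set \<Rightarrow> (int ^ 'n) set \<Rightarrow> bool"
  where "family_of_holes Q H \<longleftrightarrow> (\<exists>D. hole_decomposition Q D \<and> H \<in> D)"


section \<open>Monoid algebra and *depth\<close>

text \<open>\<open>\<K>[Q]\<close> is the subring of the group algebra \<open>\<K>[\<int>\<^sup>N]\<close>, whose multiplication is the
  convolution product of \<^typ>\<open>'a \<Rightarrow>\<^sub>0 'k\<close>, consisting of the elements supported in \<open>Q\<close>.\<close>

definition monoid_algebra :: "'a::comm_monoid_add set \<Rightarrow> ('a \<Rightarrow>\<^sub>0 'k::field) ring"
  where "monoid_algebra Q =
    \<lparr>carrier = {p. Poly_Mapping.keys p \<subseteq> Q}, monoid.mult = (*), one = 1, zero = 0, add = (+)\<rparr>"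

definition graded_maximal_ideal :: "'a::ab_group_add set \<Rightarrow> ('a \<Rightarrow>\<^sub>0 'k::field) set"
  where "graded_maximal_ideal Q = {p. Poly_Mapping.keys p \<subseteq> Q - minimal_face Q}"

text \<open>Each member of the list is a nonzerodivisor modulo the ideal generated by its predecessors,
  and the quotient by the whole sequence is nonzero.\<close>

definition regular_sequence :: "('a, 'b) ring_scheme \<Rightarrow> 'a list \<Rightarrow> bool"
  where "regular_sequence R fs \<longleftrightarrow>
    set fs \<subseteq> carrier R \<and>
    (\<forall>j<length fs. \<forall>g\<in>carrier R.
      fs ! j \<otimes>\<^bsub>R\<^esub> g \<in> genideal R (set (take j fs)) \<longrightarrow> g \<in> genideal R (set (take j fs))) \<and>
    genideal R (set fs) \<noteq> carrier R"

text \<open>The supremum is taken in \<^typ>\<open>enat\<close>, so a bound on it bounds every regular sequence.\<close>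

definition star_depth :: "'k::field itself \<Rightarrow> 'a::ab_group_add set \<Rightarrow> enat"
  where "star_depth _ Q =
    (SUP fs \<in> {fs. regular_sequence (monoid_algebra Q :: ('a \<Rightarrow>\<^sub>0 'k) ring) fs \<and>
      set fs \<subseteq> graded_maximal_ideal Q}. enat (length fs))"

lemma cring_monoid_algebra:
  assumes "add_submonoid Q"
  shows "cring (monoid_algebra Q :: ('a::comm_monoid_add \<Rightarrow>\<^sub>0 'k::field) ring)"
proof -
  have Q: "0 \<in> Q" "\<And>a b. a \<in> Q \<Longrightarrow> b \<in> Q \<Longrightarrow> a + b \<in> Q"
    using assms by (auto simp: add_submonoid_def)
  have mult: "Poly_Mapping.keys (p * r) \<subseteq> Q"
    if "Poly_Mapping.keys p \<subseteq> Q" "Poly_Mapping.keys r \<subseteq> Q" for p r :: "'a \<Rightarrow>\<^sub>0 'k"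
    using that Q(2) keys_mult[of p r] by blast
  have add: "Poly_Mapping.keys (p + r) \<subseteq> Q"
    if "Poly_Mapping.keys p \<subseteq> Q" "Poly_Mapping.keys r \<subseteq> Q" for p r :: "'a \<Rightarrow>\<^sub>0 'k"
    using that Poly_Mapping.keys_add[of p r] by blast
  have neg: "\<exists>r. Poly_Mapping.keys r \<subseteq> Q \<and> r + p = 0"
    if "Poly_Mapping.keys p \<subseteq> Q" for p :: "'a \<Rightarrow>\<^sub>0 'k"
    using that by (intro exI[of _ "- p"]) simp
  show ?thesis
    by (rule cringI; (rule abelian_groupI comm_monoidI)?)
      (use Q mult add neg in \<open>auto simp: monoid_algebra_def algebra_simps\<close>)
qed

end

theory Submission
  imports Defs
begin

text \<open>
  For a face \<open>F\<close> let \<open>Q - F\<close> be the monoid of differences and \<open>\<pp>\<^sub>F\<close> the ideal of \<open>\<K>[Q - F]\<close>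
  generated by the monomials of the generators of \<open>Q\<close> outside \<open>F\<close>; so \<open>\<K>[Q - F]\<close> is the
  homogeneous localization of \<open>\<K>[Q]\<close> at the prime of \<open>F\<close>. Say that the grade at \<open>F\<close> is at
  least \<open>t\<close> if the Koszul cohomology of these generators with coefficients in \<open>\<K>[Q - F]\<close>
  vanishes in degrees below \<open>t\<close>. The bound comes from following the grade along a chain of
  faces from \<open>F\<^sub>0\<close> to the face \<open>F\<close> of the family of holes.

  At \<open>F\<^sub>0\<close> the ring is \<open>\<K>[Q]\<close>, and a regular sequence of length \<open>t\<close> in \<open>\<mm>\<close> forces grade at
  least \<open>t\<close> (\<open>face_grade_ge_regular_sequence\<close>). Indeed the Koszul cohomology of a regular
  sequence vanishes below its length, and vanishing passes from one sequence to another as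
  soon as powers of the members of the former act on the Koszul complex of the latter by
  maps homotopic to zero (\<open>koszul_acyclic_below_radical\<close>). The regular sequence need not be
  homogeneous, but after this step only monomials occur.

  If \<open>H\<close> covers \<open>G\<close> in the face lattice, then the grade drops by at most one from \<open>G\<close> to \<open>H\<close>
  (\<open>face_grade_ge_cover\<close>): for \<open>y \<in> H\<close> outside \<open>G\<close>, the ideal \<open>\<pp>\<^sub>G\<close> of \<open>\<K>[Q - G]\<close> has the
  same radical as the ideal generated by \<open>y\<close> and the generators outside \<open>H\<close>, precisely
  because no face lies strictly between \<open>G\<close> and \<open>H\<close>. Dropping \<open>y\<close> from the sequence makes
  multiplication by \<open>y\<close> surjective on the cohomology in degrees below \<open>t - 1\<close>, and a graded
  version of Nakayama's lemma then makes this cohomology zero: a class of internal degree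
  \<open>u\<close> is \<open>y\<^sup>n\<close> times one of degree \<open>u - n y\<close>, where all cochains vanish for large \<open>n\<close>.
  Localization is exact and brings the statement to \<open>\<K>[Q - H]\<close>. As the rank increases
  strictly along chains of faces, going from \<open>F\<^sub>0\<close> to \<open>F\<close> costs at most \<open>i\<close>, the *dimension
  of \<open>F\<close>.

  At \<open>F\<close> the grade is at most one (\<open>not_face_grade_ge_2\<close>). By irredundancy of the family, a
  representative of the holes lies outside \<open>Q - F\<close> but enters it after adding a suitable
  multiple of any given \<open>a \<in> Q\<close> outside \<open>F\<close>. Hence some translate \<open>z\<close> of it is still outside
  \<open>Q - F\<close> while \<open>z + a \<in> Q - F\<close> for every generator \<open>a\<close> outside \<open>F\<close>. The monomials of these
  \<open>z + a\<close> form a Koszul cocycle of degree one over \<open>\<K>[Q - F]\<close>; it could only be the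
  coboundary of the monomial of \<open>z\<close>, which does not belong to this ring.
\<close>

section \<open>The Koszul complex\<close>

text \<open>
  A Koszul cochain of a sequence \<open>v\<^sub>1, \<dots>, v\<^sub>n\<close> is encoded as a function on lists of \<open>n\<close>
  Booleans, the list telling which of the basis vectors \<open>e\<^sub>1, \<dots>, e\<^sub>n\<close> occur in an exterior
  product. Splitting off the first Boolean exhibits the complex of \<open>v # vs\<close> as the mapping
  cone of multiplication by \<open>v\<close> on the complex of \<open>vs\<close>, so that all signs are absorbed by
  the recursion.
\<close>

definition pair_cochain :: "(bool list \<Rightarrow> 'r) \<Rightarrow> (bool list \<Rightarrow> 'r) \<Rightarrow> bool list \<Rightarrow> 'r::zero"
  where "pair_cochain c0 c1 =
    (\<lambda>bs. case bs of [] \<Rightarrow> 0 | b # bs' \<Rightarrow> if b then c1 bs' else c0 bs')"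

abbreviation low :: "(bool list \<Rightarrow> 'r) \<Rightarrow> bool list \<Rightarrow> 'r"
  where "low c \<equiv> \<lambda>bs. c (False # bs)"

abbreviation high :: "(bool list \<Rightarrow> 'r) \<Rightarrow> bool list \<Rightarrow> 'r"
  where "high c \<equiv> \<lambda>bs. c (True # bs)"

primrec koszul :: "'r::comm_ring_1 list \<Rightarrow> (bool list \<Rightarrow> 'r) \<Rightarrow> bool list \<Rightarrow> 'r"
  where
    "koszul [] c = (\<lambda>_. 0)"
  | "koszul (v # vs) c =
      pair_cochain (koszul vs (low c)) (\<lambda>bs. v * c (False # bs) - koszul vs (high c) bs)"

text \<open>
  The single identity with \<open>r * c - c'\<close> expresses additivity and homogeneity at once.
\<close>

definition linear_map :: "((bool list \<Rightarrow> 'r) \<Rightarrow> bool list \<Rightarrow> 'r::comm_ring_1) \<Rightarrow> bool"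
  where "linear_map h \<longleftrightarrow>
    (\<forall>r c c'. h (\<lambda>bs. r * c bs - c' bs) = (\<lambda>bs. r * h c bs - h c' bs))"

text \<open>
  Degrees are integers, so that cochains of degree \<open>- 1\<close> exist and are zero. The ring \<open>R\<close> of
  coefficients varies inside a fixed commutative ring: it will be the algebra of one of
  several monoids contained in a common group.
\<close>

definition cochains :: "'r::comm_ring_1 set \<Rightarrow> nat \<Rightarrow> int \<Rightarrow> (bool list \<Rightarrow> 'r) set"
  where "cochains R n j =
    {c. \<forall>bs. c bs \<in> R \<and> (c bs \<noteq> 0 \<longrightarrow> length bs = n \<and> int (count_list bs True) = j)}"

text \<open>
  Over a Noetherian ring \<open>R\<close>, and if \<open>vs\<close> generates a proper ideal, this says that this
  ideal has grade at least \<open>t\<close>.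
\<close>

definition koszul_acyclic_below :: "'r::comm_ring_1 set \<Rightarrow> 'r list \<Rightarrow> int \<Rightarrow> bool"
  where "koszul_acyclic_below R vs t \<longleftrightarrow>
    (\<forall>j<t. \<forall>c\<in>cochains R (length vs) j. koszul vs c = (\<lambda>_. 0) \<longrightarrow>
      (\<exists>b\<in>cochains R (length vs) (j - 1). koszul vs b = c))"

text \<open>
  Multiplication by \<open>x\<close> is asked to be homotopic to zero, rather than to annihilate the
  cohomology, because a homotopy extends formally to longer sequences.
\<close>

definition null_homotopic :: "'r::comm_ring_1 set \<Rightarrow> 'r list \<Rightarrow> 'r \<Rightarrow> bool"
  where "null_homotopic R vs x \<longleftrightarrow>
    (\<exists>h. linear_map h \<and> (\<forall>j. \<forall>c\<in>cochains R (length vs) j.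
      h c \<in> cochains R (length vs) (j - 1) \<and>
      (\<forall>bs. koszul vs (h c) bs + h (koszul vs c) bs = x * c bs)))"

text \<open>
  Reorderings of a sequence are treated in this form, as one half of an isomorphism of
  complexes suffices to transport the vanishing of cohomology from \<open>vs\<close> to \<open>ws\<close>.
\<close>

definition koszul_retract :: "'r::comm_ring_1 set \<Rightarrow> 'r list \<Rightarrow> 'r list \<Rightarrow> bool"
  where "koszul_retract R vs ws \<longleftrightarrow> length vs = length ws \<and>
    (\<exists>\<phi> \<psi>. linear_map \<phi> \<and> linear_map \<psi> \<and> (\<forall>j. \<forall>c\<in>cochains R (length vs) j.
      \<phi> c \<in> cochains R (length vs) j \<and> koszul ws (\<phi> c) = \<phi> (koszul vs c) \<and>
      \<psi> c \<in> cochains R (length vs) j \<and> koszul vs (\<psi> c) = \<psi> (koszul ws c) \<and> \<phi> (\<psi> c) = c))"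

lemma low_pair [simp]: "low (pair_cochain c0 c1) = c0"
  and high_pair [simp]: "high (pair_cochain c0 c1) = c1"
  and pair_Nil [simp]: "pair_cochain c0 c1 [] = 0"
  and pair_False [simp]: "pair_cochain c0 c1 (False # bs) = c0 bs"
  and pair_True [simp]: "pair_cochain c0 c1 (True # bs) = c1 bs"
  by (simp_all add: pair_cochain_def)

lemma cochain_eqI:
  assumes "c [] = c' []" "low c = low c'" "high c = high c'"
  shows "c = c'"
proof
  fix bs show "c bs = c' bs"
  proof (cases bs)
    case (Cons b bs')
    then show ?thesis using fun_cong[OF assms(2), of bs'] fun_cong[OF assms(3), of bs']
      by (cases b) auto
  qed (simp add: assms)
qed

lemma pair_eq_iff [simp]: "pair_cochain a b = pair_cochain a' b' \<longleftrightarrow> a = a' \<and> b = b'"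
  by (metis low_pair high_pair)

lemma pair_low_high: "c [] = 0 \<Longrightarrow> pair_cochain (low c) (high c) = c"
  by (rule cochain_eqI) auto

lemma zero_eq_pair: "(\<lambda>_. 0) = pair_cochain (\<lambda>_. 0) (\<lambda>_. 0)"
  by (rule cochain_eqI) auto

lemma pair_eq_zero_iff: "pair_cochain a b = (\<lambda>_. 0) \<longleftrightarrow> a = (\<lambda>_. 0) \<and> b = (\<lambda>_. 0)"
  by (subst zero_eq_pair) simp

lemma linear_mapD: "linear_map h \<Longrightarrow> h (\<lambda>bs. r * c bs - c' bs) = (\<lambda>bs. r * h c bs - h c' bs)"
  unfolding linear_map_def by blast

lemma linear_map_zero: "linear_map h \<Longrightarrow> h (\<lambda>_. 0) = (\<lambda>_. 0)"
  using linear_mapD[of h 1 "\<lambda>_. 0" "\<lambda>_. 0"] by simp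

lemma linear_map_scale: "linear_map h \<Longrightarrow> h (\<lambda>bs. r * c bs) = (\<lambda>bs. r * h c bs)"
  using linear_mapD[of h r c "\<lambda>_. 0"] by (simp add: linear_map_zero)

lemma linear_map_diff: "linear_map h \<Longrightarrow> h (\<lambda>bs. c bs - c' bs) = (\<lambda>bs. h c bs - h c' bs)"
  using linear_mapD[of h 1 c c'] by simp

lemma linear_map_uminus: "linear_map h \<Longrightarrow> h (\<lambda>bs. - c bs) = (\<lambda>bs. - h c bs)"
  using linear_mapD[of h 0 "\<lambda>_. 0" c] by simp

lemma linear_map_add: "linear_map h \<Longrightarrow> h (\<lambda>bs. c bs + c' bs) = (\<lambda>bs. h c bs + h c' bs)"
  using linear_map_diff[of h c "\<lambda>bs. - c' bs"] by (simp add: linear_map_uminus)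

lemma linear_map_pair:
  assumes "linear_map f" "linear_map g"
  shows "linear_map (\<lambda>c. pair_cochain (f (low c)) (g (high c)))"
  unfolding linear_map_def
  by (intro allI, rule cochain_eqI) (simp_all add: linear_mapD[OF assms(1)] linear_mapD[OF assms(2)])

lemma linear_map_koszul: "linear_map (koszul vs)"
proof (induction vs)
  case Nil then show ?case by (simp add: linear_map_def)
next
  case (Cons v vs)
  show ?case unfolding linear_map_def
  proof (intro allI, rule cochain_eqI)
    fix r c c'
    have IH: "koszul vs (\<lambda>bs. r * c bs - c' bs) bs = r * koszul vs c bs - koszul vs c' bs" for c c' bs
      using fun_cong[OF linear_mapD[OF Cons, of r c c'], of bs] .
    show "low (koszul (v # vs) (\<lambda>bs. r * c bs - c' bs)) =
        low (\<lambda>bs. r * koszul (v # vs) c bs - koszul (v # vs) c' bs)"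
      "high (koszul (v # vs) (\<lambda>bs. r * c bs - c' bs)) =
        high (\<lambda>bs. r * koszul (v # vs) c bs - koszul (v # vs) c' bs)"
      by (simp_all add: IH algebra_simps)
  qed simp
qed

lemmas koszul_zero [simp] = linear_map_zero[OF linear_map_koszul]
  and koszul_scale = linear_map_scale[OF linear_map_koszul]
  and koszul_diff = linear_map_diff[OF linear_map_koszul]
  and koszul_linear = linear_mapD[OF linear_map_koszul]

lemma koszul_koszul: "koszul vs (koszul vs c) = (\<lambda>_. 0)"
proof (induction vs arbitrary: c)
  case (Cons v vs)
  show ?case
    by (rule cochain_eqI) (simp_all add: Cons koszul_linear)
qed simp

lemma koszul_sum: "koszul vs (\<lambda>bs. \<Sum>u\<in>U. b u bs) = (\<lambda>bs. \<Sum>u\<in>U. koszul vs (b u) bs)"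
  by (induction U rule: infinite_finite_induct)
    (simp_all add: linear_map_add[OF linear_map_koszul])

locale unital_subring =
  fixes R :: "'r::comm_ring_1 set"
  assumes one_closed: "1 \<in> R"
    and diff_closed: "a \<in> R \<Longrightarrow> b \<in> R \<Longrightarrow> a - b \<in> R"
    and mult_closed: "a \<in> R \<Longrightarrow> b \<in> R \<Longrightarrow> a * b \<in> R"
begin

lemma zero_closed: "0 \<in> R"
  using diff_closed[OF one_closed one_closed] by simp

lemma uminus_closed: "a \<in> R \<Longrightarrow> - a \<in> R"
  using diff_closed[OF zero_closed] by force

lemma add_closed: "a \<in> R \<Longrightarrow> b \<in> R \<Longrightarrow> a + b \<in> R"
  using diff_closed[OF _ uminus_closed] by force

lemmas closed = one_closed zero_closed diff_closed mult_closed uminus_closed add_closed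

lemma cochain_low: "c \<in> cochains R (Suc n) j \<Longrightarrow> low c \<in> cochains R n j"
  by (force simp: cochains_def)

lemma cochain_high: "c \<in> cochains R (Suc n) j \<Longrightarrow> high c \<in> cochains R n (j - 1)"
  by (force simp: cochains_def)

lemma cochain_Nil: "c \<in> cochains R (Suc n) j \<Longrightarrow> c [] = 0"
  by (force simp: cochains_def)

lemma cochain_split: "c \<in> cochains R (Suc n) j \<Longrightarrow> c = pair_cochain (low c) (high c)"
  by (simp add: pair_low_high cochain_Nil)

lemma cochain_pair:
  "a \<in> cochains R n j \<Longrightarrow> b \<in> cochains R n (j - 1) \<Longrightarrow> pair_cochain a b \<in> cochains R (Suc n) j"
  by (auto simp: cochains_def pair_cochain_def zero_closed split: list.splits)

lemma cochain_zero: "(\<lambda>_. 0) \<in> cochains R n j"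
  by (auto simp: cochains_def zero_closed)

lemma cochain_scale: "r \<in> R \<Longrightarrow> c \<in> cochains R n j \<Longrightarrow> (\<lambda>bs. r * c bs) \<in> cochains R n j"
  by (auto simp: cochains_def closed) (metis mult_zero_right)+

lemma cochain_diff:
  "c \<in> cochains R n j \<Longrightarrow> c' \<in> cochains R n j \<Longrightarrow> (\<lambda>bs. c bs - c' bs) \<in> cochains R n j"
  by (auto simp: cochains_def closed) (metis diff_zero)+

lemma cochain_add:
  "c \<in> cochains R n j \<Longrightarrow> c' \<in> cochains R n j \<Longrightarrow> (\<lambda>bs. c bs + c' bs) \<in> cochains R n j"
  by (auto simp: cochains_def closed) (metis add_0)+

lemma cochain_uminus: "c \<in> cochains R n j \<Longrightarrow> (\<lambda>bs. - c bs) \<in> cochains R n j"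
  by (auto simp: cochains_def closed)

lemma cochain_sum:
  "(\<And>u. u \<in> U \<Longrightarrow> b u \<in> cochains R n j) \<Longrightarrow> (\<lambda>bs. \<Sum>u\<in>U. b u bs) \<in> cochains R n j"
  by (induction U rule: infinite_finite_induct) (auto intro: cochain_zero cochain_add)

lemma koszul_cochain:
  "set vs \<subseteq> R \<Longrightarrow> c \<in> cochains R (length vs) j \<Longrightarrow> koszul vs c \<in> cochains R (length vs) (j + 1)"
proof (induction vs arbitrary: c j)
  case Nil then show ?case by (simp add: cochain_zero)
next
  case (Cons v vs)
  have "low c \<in> cochains R (length vs) j" "high c \<in> cochains R (length vs) (j - 1)"
    using Cons.prems by (auto intro: cochain_low cochain_high)
  then show ?case using Cons.prems Cons.IH[of "low c" j] Cons.IH[of "high c" "j - 1"]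
    by (auto intro!: cochain_pair cochain_diff cochain_scale)
qed

section \<open>Adding and removing members of the sequence\<close>

text \<open>
  This is the long exact sequence of the mapping cone, read off by hand: the first component
  of a cocycle is a coboundary of some \<open>b0\<close>, and correcting the second component by \<open>w * b0\<close>
  makes it a cocycle again.
\<close>

lemma koszul_acyclic_below_Cons:
  assumes "koszul_acyclic_below R vs t" "set (w # vs) \<subseteq> R"
  shows "koszul_acyclic_below R (w # vs) t"
  unfolding koszul_acyclic_below_def
proof (intro allI impI ballI)
  fix j c assume j: "j < t" and c: "c \<in> cochains R (length (w # vs)) j"
    and cyc: "koszul (w # vs) c = (\<lambda>_. 0)"
  note c' = cochain_low[OF c[simplified]] cochain_high[OF c[simplified]]
  have cyc': "koszul vs (low c) = (\<lambda>_. 0)" "\<And>bs. w * c (False # bs) = koszul vs (high c) bs"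
    using cyc by (auto simp: pair_eq_zero_iff dest: fun_cong)
  obtain b0 where b0: "b0 \<in> cochains R (length vs) (j - 1)" "koszul vs b0 = low c"
    using assms(1) j c'(1) cyc'(1) unfolding koszul_acyclic_below_def by blast
  let ?d = "\<lambda>bs. w * b0 bs - high c bs"
  have "?d \<in> cochains R (length vs) (j - 1)"
    using b0(1) c'(2) assms(2) by (intro cochain_diff cochain_scale) auto
  moreover have "koszul vs ?d = (\<lambda>_. 0)"
    by (simp add: koszul_linear b0(2) cyc'(2))
  moreover have "j - 1 < t" using j by simp
  ultimately obtain b1 where b1: "b1 \<in> cochains R (length vs) (j - 1 - 1)" "koszul vs b1 = ?d"
    using assms(1) unfolding koszul_acyclic_below_def by blast
  have "koszul (w # vs) (pair_cochain b0 b1) = pair_cochain (low c) (high c)"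
    by (simp add: b0 b1)
  then show "\<exists>b\<in>cochains R (length (w # vs)) (j - 1). koszul (w # vs) b = c"
    using cochain_pair[OF b0(1) b1(1)] cochain_split[OF c[simplified]]
    by (intro bexI[of _ "pair_cochain b0 b1"]) auto
qed

lemma koszul_acyclic_below_append:
  assumes "koszul_acyclic_below R vs t" "set (ws @ vs) \<subseteq> R"
  shows "koszul_acyclic_below R (ws @ vs) t"
  using assms by (induction ws) (simp_all add: koszul_acyclic_below_Cons)

text \<open>
  If \<open>w * c\<close> is the coboundary of \<open>b\<close>, then \<open>(c, b)\<close> is a cocycle for \<open>w # vs\<close>. So
  multiplication by \<open>w\<close> is injective on the cohomology of \<open>vs\<close> below degree \<open>t\<close>.
\<close>

lemma coboundary_of_scaled_coboundary:
  assumes "koszul_acyclic_below R (w # vs) t" "j < t"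
    and c: "c \<in> cochains R (length vs) j" "koszul vs c = (\<lambda>_. 0)"
    and b: "b \<in> cochains R (length vs) (j - 1)" "koszul vs b = (\<lambda>bs. w * c bs)"
  shows "\<exists>b\<in>cochains R (length vs) (j - 1). koszul vs b = c"
proof -
  have "koszul (w # vs) (pair_cochain c b) = (\<lambda>_. 0)"
    by (simp add: c b pair_eq_zero_iff)
  moreover have "pair_cochain c b \<in> cochains R (length (w # vs)) j"
    using cochain_pair[OF c(1) b(1)] by simp
  ultimately obtain e where e: "e \<in> cochains R (length (w # vs)) (j - 1)"
    "koszul (w # vs) e = pair_cochain c b"
    using assms(1,2) unfolding koszul_acyclic_below_def by blast
  then have "koszul vs (low e) = c" by simp
  then show ?thesis using cochain_low[of e "length vs" "j - 1"] e(1) by auto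
qed

text \<open>
  On the cohomology of \<open>vs\<close>, multiplication by \<open>w\<close> is injective in the degrees considered
  and nilpotent by the homotopy.
\<close>

lemma koszul_acyclic_below_remove:
  assumes "koszul_acyclic_below R (w # vs) t" "null_homotopic R vs (w ^ k)" "w \<in> R"
  shows "koszul_acyclic_below R vs t"
  unfolding koszul_acyclic_below_def
proof (intro allI impI ballI)
  fix j c assume j: "j < t" and c: "c \<in> cochains R (length vs) j" "koszul vs c = (\<lambda>_. 0)"
  have "\<exists>b\<in>cochains R (length vs) (j - 1). koszul vs b = c"
    if "\<exists>b\<in>cochains R (length vs) (j - 1). koszul vs b = (\<lambda>bs. w ^ k * c bs)"
      "c \<in> cochains R (length vs) j" "koszul vs c = (\<lambda>_. 0)" for k c
    using that
  proof (induction k arbitrary: c)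
    case (Suc k)
    let ?c = "\<lambda>bs. w * c bs"
    have wc: "?c \<in> cochains R (length vs) j" "koszul vs ?c = (\<lambda>_. 0)"
      using Suc.prems assms(3) by (auto intro: cochain_scale simp: koszul_scale)
    have eq: "(\<lambda>bs. w ^ k * ?c bs) = (\<lambda>bs. w ^ Suc k * c bs)"
      by (auto simp: algebra_simps)
    have "\<exists>b\<in>cochains R (length vs) (j - 1). koszul vs b = ?c"
      using Suc.IH[of ?c, OF _ wc] Suc.prems(1) unfolding eq by blast
    then show ?case
      using coboundary_of_scaled_coboundary[OF assms(1) j] Suc.prems(2,3) by blast
  qed simp
  moreover have "\<exists>b\<in>cochains R (length vs) (j - 1). koszul vs b = (\<lambda>bs. w ^ k * c bs)"
  proof -
    obtain h where h: "linear_map h" "\<And>j c. c \<in> cochains R (length vs) j \<Longrightarrow>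
      h c \<in> cochains R (length vs) (j - 1) \<and>
      (\<forall>bs. koszul vs (h c) bs + h (koszul vs c) bs = w ^ k * c bs)"
      using assms(2) unfolding null_homotopic_def by blast
    have "koszul vs (h c) = (\<lambda>bs. w ^ k * c bs)"
      using h(2)[OF c(1)] c(2) linear_map_zero[OF h(1)] by auto
    then show ?thesis using h(2)[OF c(1)] by blast
  qed
  ultimately show "\<exists>b\<in>cochains R (length vs) (j - 1). koszul vs b = c" using c by blast
qed

text \<open>
  Multiplication by \<open>w\<close> is surjective on the cohomology of \<open>vs\<close> below degree \<open>t - 1\<close>,
  because a cocycle \<open>c\<close> of \<open>vs\<close> gives the cocycle \<open>(0, c)\<close> of \<open>w # vs\<close>, in the next degree.
  One degree is lost here, and this is the only place in the argument where the grade drops.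
\<close>

lemma cocycle_divisible_mod_coboundaries:
  assumes "koszul_acyclic_below R (w # vs) t" "j < t - 1" "set (w # vs) \<subseteq> R"
    and c: "c \<in> cochains R (length vs) j" "koszul vs c = (\<lambda>_. 0)"
  obtains c' b where "c' \<in> cochains R (length vs) j" "koszul vs c' = (\<lambda>_. 0)"
    "b \<in> cochains R (length vs) (j - 1)" "c = (\<lambda>bs. w * c' bs - koszul vs b bs)"
proof -
  let ?e = "pair_cochain (\<lambda>_. 0) c"
  have "koszul (w # vs) ?e = (\<lambda>_. 0)" by (simp add: c pair_eq_zero_iff)
  moreover have "?e \<in> cochains R (length (w # vs)) (j + 1)"
    using cochain_pair[of "\<lambda>_. 0" "length vs" "j + 1" c] c cochain_zero by simp
  moreover have "j + 1 < t" using assms by simp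
  ultimately obtain e where e: "e \<in> cochains R (length (w # vs)) (j + 1 - 1)"
    "koszul (w # vs) e = ?e"
    using assms(1) unfolding koszul_acyclic_below_def by blast
  show ?thesis
    by (rule that[of "low e" "high e"])
      (use e cochain_low[of e "length vs" j] cochain_high[of e "length vs" j] in auto)
qed

section \<open>Elements acting by maps homotopic to zero\<close>

text \<open>
  The homotopy for \<open>vs\<close> acts on both components of the cone, with a sign on the second one.
\<close>

lemma null_homotopic_Cons:
  assumes "null_homotopic R vs x" "w \<in> R"
  shows "null_homotopic R (w # vs) x"
proof -
  obtain h where h: "linear_map h" "\<And>j c. c \<in> cochains R (length vs) j \<Longrightarrow>
      h c \<in> cochains R (length vs) (j - 1) \<and>
      (\<forall>bs. koszul vs (h c) bs + h (koszul vs c) bs = x * c bs)"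
    using assms(1) unfolding null_homotopic_def by blast
  let ?h = "\<lambda>c. pair_cochain (h (low c)) (\<lambda>bs. - h (high c) bs)"
  have lin: "linear_map (\<lambda>c bs. - h c bs)"
    using h(1) by (auto simp: linear_map_def)
  have hom: "?h c \<in> cochains R (length (w # vs)) (j - 1) \<and>
      (\<forall>bs. koszul (w # vs) (?h c) bs + ?h (koszul (w # vs) c) bs = x * c bs)"
    if c: "c \<in> cochains R (length (w # vs)) j" for j c
  proof -
    note c' = cochain_low[OF c[simplified]] cochain_high[OF c[simplified]]
    note h0 = h(2)[OF c'(1)] and h1 = h(2)[OF c'(2)]
    have 1: "?h c \<in> cochains R (length (w # vs)) (j - 1)"
      using h0 h1 by (auto intro!: cochain_pair cochain_uminus)
    have kosneg: "koszul vs (\<lambda>bs. - h (high c) bs) = (\<lambda>bs. - koszul vs (h (high c)) bs)"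
      by (rule linear_map_uminus[OF linear_map_koszul])
    have 2: "h (\<lambda>bs. w * low c bs - koszul vs (high c) bs) =
      (\<lambda>bs. w * h (low c) bs - h (koszul vs (high c)) bs)"
      by (rule linear_mapD[OF h(1)])
    have "(\<lambda>bs. koszul (w # vs) (?h c) bs + ?h (koszul (w # vs) c) bs) = (\<lambda>bs. x * c bs)"
      by (rule cochain_eqI)
        (use h0 h1 cochain_Nil[OF c[simplified]] in \<open>auto simp: 2 kosneg\<close>)
    then show ?thesis using 1 by (auto simp: fun_eq_iff)
  qed
  show ?thesis unfolding null_homotopic_def
    by (intro exI[of _ ?h] conjI allI ballI linear_map_pair h(1) lin) (use hom in auto)
qed

text \<open>
  The homotopy is contraction with the first basis vector.
\<close>

lemma null_homotopic_head:
  assumes "w \<in> R"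
  shows "null_homotopic R (w # vs) w"
proof -
  let ?h = "\<lambda>c. pair_cochain (high c) (\<lambda>_. 0)"
  have hom: "?h c \<in> cochains R (length (w # vs)) (j - 1) \<and>
      (\<forall>bs. koszul (w # vs) (?h c) bs + ?h (koszul (w # vs) c) bs = w * c bs)"
    if c: "c \<in> cochains R (length (w # vs)) j" for j c
  proof -
    note c' = cochain_high[OF c[simplified]]
    have "(\<lambda>bs. koszul (w # vs) (?h c) bs + ?h (koszul (w # vs) c) bs) = (\<lambda>bs. w * c bs)"
      by (rule cochain_eqI) (use cochain_Nil[OF c[simplified]] in auto)
    then show ?thesis using cochain_pair[OF c' cochain_zero] by (auto simp: fun_eq_iff)
  qed
  have lin: "linear_map ?h" unfolding linear_map_def by (intro allI, rule cochain_eqI) auto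
  show ?thesis unfolding null_homotopic_def
    by (intro exI[of _ ?h] conjI allI ballI lin) (use hom in auto)
qed

lemma null_homotopic_member:
  assumes "v \<in> set vs" "set vs \<subseteq> R"
  shows "null_homotopic R vs v"
  using assms
proof (induction vs)
  case (Cons w vs)
  then show ?case
    by (cases "v = w") (auto intro: null_homotopic_head null_homotopic_Cons)
qed simp

lemma null_homotopic_zero: "null_homotopic R vs 0"
  unfolding null_homotopic_def
  by (intro exI[of _ "\<lambda>_ _. 0"]) (auto simp: linear_map_def cochain_zero)

lemma null_homotopic_linear:
  assumes "null_homotopic R vs x" "null_homotopic R vs y" "r \<in> R"
  shows "null_homotopic R vs (r * x - y)"
proof -
  obtain h where h: "linear_map h" "\<And>j c. c \<in> cochains R (length vs) j \<Longrightarrow>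
      h c \<in> cochains R (length vs) (j - 1) \<and>
      (\<forall>bs. koszul vs (h c) bs + h (koszul vs c) bs = x * c bs)"
    using assms(1) unfolding null_homotopic_def by blast
  obtain g where g: "linear_map g" "\<And>j c. c \<in> cochains R (length vs) j \<Longrightarrow>
      g c \<in> cochains R (length vs) (j - 1) \<and>
      (\<forall>bs. koszul vs (g c) bs + g (koszul vs c) bs = y * c bs)"
    using assms(2) unfolding null_homotopic_def by blast
  let ?h = "\<lambda>c bs. r * h c bs - g c bs"
  have "linear_map ?h" unfolding linear_map_def
    by (simp add: linear_mapD[OF h(1)] linear_mapD[OF g(1)] algebra_simps)
  moreover have "?h c \<in> cochains R (length vs) (j - 1) \<and>
      (\<forall>bs. koszul vs (?h c) bs + ?h (koszul vs c) bs = (r * x - y) * c bs)"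
    if c: "c \<in> cochains R (length vs) j" for j c
  proof -
    have "koszul vs (?h c) bs + ?h (koszul vs c) bs = (r * x - y) * c bs" for bs
    proof -
      have "koszul vs (?h c) bs + ?h (koszul vs c) bs =
        r * (koszul vs (h c) bs + h (koszul vs c) bs) - (koszul vs (g c) bs + g (koszul vs c) bs)"
        by (simp add: koszul_linear algebra_simps)
      then show ?thesis using h(2)[OF c] g(2)[OF c] by (simp add: algebra_simps)
    qed
    then show ?thesis using h(2)[OF c] g(2)[OF c] assms(3)
      by (auto intro!: cochain_diff cochain_scale)
  qed
  ultimately show ?thesis unfolding null_homotopic_def by blast
qed

lemma null_homotopic_mult: "null_homotopic R vs x \<Longrightarrow> r \<in> R \<Longrightarrow> null_homotopic R vs (r * x)"
  using null_homotopic_linear[of vs x 0 r] by (simp add: null_homotopic_zero)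

lemma null_homotopic_add:
  assumes "null_homotopic R vs x" "null_homotopic R vs y"
  shows "null_homotopic R vs (x + y)"
proof -
  have "null_homotopic R vs (- y)"
    using null_homotopic_linear[OF null_homotopic_zero assms(2) zero_closed] by simp
  from null_homotopic_linear[OF assms(1) this one_closed] show ?thesis by simp
qed

lemma null_homotopic_sum:
  "(\<And>x. x \<in> A \<Longrightarrow> null_homotopic R vs (f x)) \<Longrightarrow> null_homotopic R vs (sum f A)"
  by (induction A rule: infinite_finite_induct) (auto intro: null_homotopic_zero null_homotopic_add)

section \<open>Independence of the order and of the radical\<close>

lemma koszul_retract_refl: "koszul_retract R vs vs"
  unfolding koszul_retract_def
  by (intro conjI exI[of _ "\<lambda>c. c"]) (auto simp: linear_map_def)

lemma koszul_retract_trans: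
  assumes "koszul_retract R us vs" "koszul_retract R vs ws"
  shows "koszul_retract R us ws"
proof -
  from assms(1) obtain \<phi> \<psi> where 1: "length us = length vs" "linear_map \<phi>" "linear_map \<psi>"
    "\<And>j c. c \<in> cochains R (length us) j \<Longrightarrow>
      \<phi> c \<in> cochains R (length us) j \<and> koszul vs (\<phi> c) = \<phi> (koszul us c) \<and>
      \<psi> c \<in> cochains R (length us) j \<and> koszul us (\<psi> c) = \<psi> (koszul vs c) \<and> \<phi> (\<psi> c) = c"
    unfolding koszul_retract_def by blast
  from assms(2) obtain \<phi>' \<psi>' where 2: "length vs = length ws" "linear_map \<phi>'" "linear_map \<psi>'"
    "\<And>j c. c \<in> cochains R (length vs) j \<Longrightarrow>
      \<phi>' c \<in> cochains R (length vs) j \<and> koszul ws (\<phi>' c) = \<phi>' (koszul vs c) \<and>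
      \<psi>' c \<in> cochains R (length vs) j \<and> koszul vs (\<psi>' c) = \<psi>' (koszul ws c) \<and> \<phi>' (\<psi>' c) = c"
    unfolding koszul_retract_def by blast
  show ?thesis unfolding koszul_retract_def
  proof (rule conjI, goal_cases len maps)
    case maps
    show ?case
    proof (rule exI[of _ "\<lambda>c. \<phi>' (\<phi> c)"], rule exI[of _ "\<lambda>c. \<psi> (\<psi>' c)"], intro conjI allI ballI)
      show "linear_map (\<lambda>c. \<phi>' (\<phi> c))" "linear_map (\<lambda>c. \<psi> (\<psi>' c))"
        using 1(2,3) 2(2,3) by (simp_all add: linear_map_def)
    qed (use 1(1,4) 2(1,4) in \<open>metis\<close>)+
  qed (use 1(1) 2(1) in auto)
qed

lemma koszul_retract_Cons:
  assumes "koszul_retract R vs ws"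
  shows "koszul_retract R (x # vs) (x # ws)"
proof -
  from assms obtain \<phi> \<psi> where 1: "length vs = length ws" "linear_map \<phi>" "linear_map \<psi>"
    "\<And>j c. c \<in> cochains R (length vs) j \<Longrightarrow>
      \<phi> c \<in> cochains R (length vs) j \<and> koszul ws (\<phi> c) = \<phi> (koszul vs c) \<and>
      \<psi> c \<in> cochains R (length vs) j \<and> koszul vs (\<psi> c) = \<psi> (koszul ws c) \<and> \<phi> (\<psi> c) = c"
    unfolding koszul_retract_def by blast
  let ?p = "\<lambda>f c. pair_cochain (f (low c)) (f (high c))"
  show ?thesis unfolding koszul_retract_def
  proof (rule conjI, goal_cases len maps)
    case maps
    show ?case
    proof (rule exI[of _ "?p \<phi>"], rule exI[of _ "?p \<psi>"], intro conjI allI ballI linear_map_pair 1(2,3))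
      fix j c assume c: "c \<in> cochains R (length (x # vs)) j"
      note c' = cochain_low[OF c[simplified]] cochain_high[OF c[simplified]]
      note p = 1(4)[OF c'(1)] 1(4)[OF c'(2)]
      show "?p \<phi> c \<in> cochains R (length (x # vs)) j" "?p \<psi> c \<in> cochains R (length (x # vs)) j"
        using p by (auto intro: cochain_pair)
      show "koszul (x # ws) (?p \<phi> c) = ?p \<phi> (koszul (x # vs) c)"
        "koszul (x # vs) (?p \<psi> c) = ?p \<psi> (koszul (x # ws) c)"
        using p by (auto simp: linear_mapD[OF 1(2)] linear_mapD[OF 1(3)])
      show "?p \<phi> (?p \<psi> c) = c" using p cochain_split[OF c[simplified]] by simp
    qed
  qed (use 1(1) in auto)
qed

text \<open>
  Exchanging the first two basis vectors changes the sign of the components in which both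
  occur.
\<close>

lemma koszul_retract_swap: "koszul_retract R (x # y # vs) (y # x # vs)"
proof -
  let ?s = "\<lambda>c. pair_cochain (pair_cochain (low (low c)) (low (high c)))
    (pair_cochain (high (low c)) (\<lambda>bs. - high (high c) bs))"
  have lin: "linear_map ?s"
    unfolding linear_map_def by (intro allI, rule cochain_eqI; (rule cochain_eqI)?) (auto simp: fun_eq_iff)
  have coc: "?s c \<in> cochains R (Suc (Suc n)) j" if c: "c \<in> cochains R (Suc (Suc n)) j" for c n j
    using cochain_low[OF cochain_low[OF c]] cochain_high[OF cochain_low[OF c]]
      cochain_low[OF cochain_high[OF c]] cochain_high[OF cochain_high[OF c]]
    by (intro cochain_pair cochain_uminus) auto
  have kos: "koszul (b # a # vs) (?s c) = ?s (koszul (a # b # vs) c)"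
    for a b n c
    by (rule cochain_eqI; (rule cochain_eqI)?)
      (auto simp: koszul_linear algebra_simps linear_map_uminus[OF linear_map_koszul])
  have inv: "?s (?s c) = c" if c: "c \<in> cochains R (Suc (Suc n)) j" for c n j
    using cochain_Nil[OF c] cochain_Nil[OF cochain_low[OF c]] cochain_Nil[OF cochain_high[OF c]]
    using pair_low_high[of c] pair_low_high[of "low c"] pair_low_high[of "high c"] by simp
  show ?thesis unfolding koszul_retract_def
    by (intro conjI exI[of _ ?s] allI ballI lin) (use coc kos inv in \<open>auto simp del: koszul.simps\<close>)
qed

lemma koszul_retract_move: "koszul_retract R (w # vs @ us) (vs @ w # us)"
proof (induction vs)
  case (Cons v vs)
  have "koszul_retract R (w # v # vs @ us) (v # w # vs @ us)" by (rule koszul_retract_swap)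
  moreover have "koszul_retract R (v # w # vs @ us) (v # vs @ w # us)"
    using Cons by (rule koszul_retract_Cons)
  ultimately show ?case using koszul_retract_trans by auto
qed (simp add: koszul_retract_refl)

lemma koszul_retract_append: "koszul_retract R (vs @ ws) (ws @ vs)"
proof (induction vs arbitrary: ws)
  case (Cons v vs)
  have "koszul_retract R (v # (vs @ ws)) (v # (ws @ vs))" by (rule koszul_retract_Cons[OF Cons])
  then show ?case using koszul_retract_move[of v ws vs] koszul_retract_trans by auto
qed (simp add: koszul_retract_refl)

lemma koszul_acyclic_below_retract:
  assumes "koszul_retract R vs ws" "koszul_acyclic_below R vs t"
  shows "koszul_acyclic_below R ws t"
proof -
  from assms obtain \<phi> \<psi> where 1: "length vs = length ws" "linear_map \<phi>" "linear_map \<psi>"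
    "\<And>j c. c \<in> cochains R (length vs) j \<Longrightarrow>
      \<phi> c \<in> cochains R (length vs) j \<and> koszul ws (\<phi> c) = \<phi> (koszul vs c) \<and>
      \<psi> c \<in> cochains R (length vs) j \<and> koszul vs (\<psi> c) = \<psi> (koszul ws c) \<and> \<phi> (\<psi> c) = c"
    unfolding koszul_retract_def by blast
  show ?thesis unfolding koszul_acyclic_below_def
  proof (intro allI impI ballI)
    fix j c assume j: "j < t" and c: "c \<in> cochains R (length ws) j" "koszul ws c = (\<lambda>_. 0)"
    have "\<psi> c \<in> cochains R (length vs) j" "koszul vs (\<psi> c) = (\<lambda>_. 0)" "\<phi> (\<psi> c) = c"
      using 1(4)[of c j] c 1(1) linear_map_zero[OF 1(3)] by auto
    moreover from this obtain b where "b \<in> cochains R (length vs) (j - 1)" "koszul vs b = \<psi> c"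
      using assms(2) j unfolding koszul_acyclic_below_def by blast
    ultimately show "\<exists>b\<in>cochains R (length ws) (j - 1). koszul ws b = c"
      using 1(1,4) by metis
  qed
qed

text \<open>
  The grade of an ideal depends only on its radical. All of \<open>ws\<close> is first appended to \<open>vs\<close>,
  and then the members of \<open>vs\<close> are removed one by one.
\<close>

lemma koszul_acyclic_below_radical:
  assumes "koszul_acyclic_below R vs t" "set vs \<subseteq> R" "set ws \<subseteq> R"
    and "\<And>v. v \<in> set vs \<Longrightarrow> \<exists>k. null_homotopic R ws (v ^ k)"
  shows "koszul_acyclic_below R ws t"
proof -
  have "koszul_acyclic_below R (vs @ ws) t"
    using koszul_acyclic_below_append[OF assms(1), of ws] assms(2,3)
      koszul_acyclic_below_retract[OF koszul_retract_append] by auto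
  then show ?thesis using assms(2,4)
  proof (induction vs)
    case (Cons v vs)
    obtain k where "null_homotopic R ws (v ^ k)" using Cons.prems by auto
    then have "null_homotopic R (vs @ ws) (v ^ k)"
      using Cons.prems(2) by (induction vs) (auto intro: null_homotopic_Cons)
    then show ?case using Cons koszul_acyclic_below_remove by auto
  qed simp
qed

end

section \<open>Regular sequences and cohomology in degree one\<close>

context unital_subring begin

lemma koszul_in_ideal:
  assumes "0 \<in> I" "\<And>a b. a \<in> I \<Longrightarrow> b \<in> I \<Longrightarrow> a - b \<in> I" "\<And>r a. r \<in> R \<Longrightarrow> a \<in> I \<Longrightarrow> a * r \<in> I"
    and "set vs \<subseteq> I" "\<And>bs. c bs \<in> R"
  shows "koszul vs c bs \<in> I"
  using assms(4,5)
proof (induction vs arbitrary: c bs)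
  case Nil then show ?case using assms(1) by simp
next
  case (Cons v vs)
  have "koszul vs (low c) bs' \<in> I" "koszul vs (high c) bs' \<in> I" "v * c (False # bs') \<in> I" for bs'
    using Cons assms(3) by auto
  then show ?case
    using assms(1,2) by (auto simp: pair_cochain_def split: list.splits)
qed

text \<open>
  If \<open>f\<close> is a nonzerodivisor modulo the ideal \<open>I\<close> generated by \<open>vs\<close>, then prepending \<open>f\<close>
  gains one degree. The only new degree is the length \<open>n\<close> of \<open>vs\<close>, where the cohomology of
  \<open>vs\<close> is \<open>R / I\<close> and \<open>f\<close> acts injectively. The set \<open>I\<close> is kept abstract: the members of
  \<open>vs\<close> lie in it and its elements act by maps homotopic to zero.
\<close>

lemma koszul_acyclic_below_regular_Cons:
  assumes V: "koszul_acyclic_below R vs (int (length vs))" and R: "set (f # vs) \<subseteq> R"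
    and I: "0 \<in> I" "\<And>a b. a \<in> I \<Longrightarrow> b \<in> I \<Longrightarrow> a - b \<in> I" "\<And>r a. r \<in> R \<Longrightarrow> a \<in> I \<Longrightarrow> a * r \<in> I"
      "set vs \<subseteq> I" "\<And>x. x \<in> I \<Longrightarrow> null_homotopic R vs x"
    and nzd: "\<And>g. g \<in> R \<Longrightarrow> f * g \<in> I \<Longrightarrow> g \<in> I"
  shows "koszul_acyclic_below R (f # vs) (int (length (f # vs)))"
  unfolding koszul_acyclic_below_def
proof (intro allI impI ballI)
  let ?n = "length vs" and ?top = "replicate (length vs) True"
  fix j c assume j: "j < int (length (f # vs))" and c: "c \<in> cochains R (length (f # vs)) j"
    and cyc: "koszul (f # vs) c = (\<lambda>_. 0)"
  show "\<exists>b\<in>cochains R (length (f # vs)) (j - 1). koszul (f # vs) b = c"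
  proof (cases "j < int ?n")
    case True
    then show ?thesis using koszul_acyclic_below_Cons[OF V R] c cyc
      unfolding koszul_acyclic_below_def by blast
  next
    case False
    then have j: "j = int ?n" using j by simp
    note c' = cochain_low[OF c[simplified]] cochain_high[OF c[simplified]]
    have cyc': "\<And>bs. f * c (False # bs) = koszul vs (high c) bs"
      using cyc by (auto simp: pair_eq_zero_iff dest: fun_cong)
    \<comment> \<open>The top coefficient of \<open>low c\<close> lies in \<open>I\<close>, as \<open>f\<close> times it is a coefficient of a coboundary.\<close>
    have "high c bs \<in> R" for bs using c by (auto simp: cochains_def)
    then have "koszul vs (high c) ?top \<in> I" by (intro koszul_in_ideal I)
    then have "f * c (False # ?top) \<in> I" using cyc' by simp
    moreover have "c (False # ?top) \<in> R" using c by (auto simp: cochains_def)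
    ultimately have "null_homotopic R vs (c (False # ?top))" using nzd I(5) by blast
    then obtain h where h: "linear_map h" "\<And>j e. e \<in> cochains R ?n j \<Longrightarrow>
      h e \<in> cochains R ?n (j - 1) \<and>
      (\<forall>bs. koszul vs (h e) bs + h (koszul vs e) bs = c (False # ?top) * e bs)"
      unfolding null_homotopic_def by blast
    \<comment> \<open>The homotopy for the top coefficient, applied to the top basis vector, which is a cocycle, shows that \<open>low c\<close> is a coboundary.\<close>
    let ?d = "\<lambda>bs. if bs = ?top then 1 else 0 :: 'r"
    have cnt: "bs = ?top" if "length bs = ?n" "count_list bs True = ?n" for bs
    proof -
      have "count_list bs True = length (filter (\<lambda>b. b) bs)"
        by (induction bs) auto
      then have "filter (\<lambda>b. b) bs = bs" using that
        by (metis length_filter_less less_irrefl filter_True)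
      then have "\<forall>b\<in>set bs. b" by (metis filter_id_conv)
      then show ?thesis using that(1) by (metis (full_types) replicate_eqI)
    qed
    have cnt': "count_list ?top True = ?n" by (induction vs) auto
    have d: "?d \<in> cochains R ?n (int ?n)"
      using cnt' by (auto simp: cochains_def closed)
    have "koszul vs ?d \<in> cochains R ?n (int ?n + 1)" using koszul_cochain d R by auto
    then have "koszul vs ?d bs = 0" for bs
      using count_le_length[of bs True] by (fastforce simp: cochains_def)
    then have "koszul vs ?d = (\<lambda>_. 0)" by auto
    then have hd: "h ?d \<in> cochains R ?n (j - 1)" "\<And>bs. koszul vs (h ?d) bs = c (False # ?top) * ?d bs"
      using h(2)[OF d] linear_map_zero[OF h(1)] j by auto
    have low: "low c bs = c (False # ?top) * ?d bs" for bs
    proof (cases "bs = ?top")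
      case False
      then have "low c bs = 0" using c'(1) cnt[of bs] unfolding cochains_def j of_nat_eq_iff by blast
      then show ?thesis using False by simp
    qed simp
    define b0 where "b0 = h ?d"
    have b0: "b0 \<in> cochains R ?n (j - 1)" "koszul vs b0 = low c"
      unfolding b0_def by (rule hd(1)) (rule ext, rule trans[OF hd(2) low[symmetric]])
    let ?e = "\<lambda>bs. f * b0 bs - high c bs"
    have "?e \<in> cochains R ?n (j - 1)"
      using b0(1) c'(2) R by (intro cochain_diff cochain_scale) auto
    moreover have "koszul vs ?e = (\<lambda>_. 0)"
      by (simp add: koszul_linear b0(2) cyc')
    moreover have "j - 1 < int ?n" using j by simp
    ultimately obtain b1 where b1: "b1 \<in> cochains R ?n (j - 1 - 1)" "koszul vs b1 = ?e"
      using V unfolding koszul_acyclic_below_def by blast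
    show ?thesis
      using cochain_pair[OF b0(1) b1(1)] cochain_split[OF c[simplified]] b0 b1
      by (intro bexI[of _ "pair_cochain b0 b1"]) auto
  qed
qed

lemma koszul_acyclic_below_Nil: "koszul_acyclic_below R [] 0"
  by (auto simp: koszul_acyclic_below_def cochains_def)

text \<open>
  This extension property is what grade two means in degree one: the products of \<open>z\<close> with
  the members of the sequence are the coboundary of \<open>z\<close> over the ambient ring, hence a
  cocycle over \<open>R\<close>; the cochain of degree zero over \<open>R\<close> that bounds it must be \<open>z\<close>, since
  \<open>w\<close> is cancellable.
\<close>

lemma mem_if_multiples_mem:
  assumes V: "koszul_acyclic_below R (w # vs) 2" and R: "set (w # vs) \<subseteq> R"
    and z: "\<And>v. v \<in> set (w # vs) \<Longrightarrow> v * z \<in> R" and w: "\<And>x. w * x = 0 \<Longrightarrow> x = 0"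
  shows "z \<in> R"
proof -
  interpret U: unital_subring "UNIV :: 'r set" by unfold_locales auto
  let ?e = "\<lambda>n bs. if bs = replicate n False then z else 0"
  let ?n = "length (w # vs)"
  have cnt: "count_list (replicate n False) True = 0" for n by (induction n) auto
  have e: "?e n \<in> cochains UNIV n 0" for n
    using cnt by (auto simp: cochains_def)
  have val: "koszul us (?e (length us)) bs \<in> R" if "\<And>v. v \<in> set us \<Longrightarrow> v * z \<in> R" for us bs
    using that
  proof (induction us arbitrary: bs)
    case (Cons u us)
    have "low (?e (length (u # us))) = ?e (length us)" "high (?e (length (u # us))) = (\<lambda>_. 0)"
      by auto
    then show ?case using Cons
      by (auto simp: pair_cochain_def zero_closed split: list.splits)
  qed (simp add: zero_closed)
  let ?c = "koszul (w # vs) (?e ?n)"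
  have "?c \<in> cochains UNIV ?n (0 + 1)" by (intro U.koszul_cochain e) auto
  then have "?c \<in> cochains R ?n 1"
    using val[of "w # vs"] z unfolding cochains_def by auto
  moreover have "koszul (w # vs) ?c = (\<lambda>_. 0)" by (rule koszul_koszul)
  ultimately obtain b where b: "b \<in> cochains R ?n (1 - 1)" "koszul (w # vs) b = ?c"
    using V unfolding koszul_acyclic_below_def by (metis one_less_numeral_iff semiring_norm(76))
  let ?d = "\<lambda>bs. ?e ?n bs - b bs"
  have "b \<in> cochains UNIV ?n 0" using b(1) by (auto simp: cochains_def)
  with e have "?d \<in> cochains UNIV ?n 0" by (rule U.cochain_diff)
  then have "?d \<in> cochains UNIV (Suc (length vs)) 0" by (simp only: length_Cons)
  then have "high ?d \<in> cochains UNIV (length vs) (0 - 1)" by (rule U.cochain_high)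
  then have "high ?d = (\<lambda>_. 0)" by (force simp: cochains_def)
  moreover have "koszul (w # vs) ?d = (\<lambda>_. 0)"
    using b(2) by (simp only: koszul_diff) simp
  ultimately have "(\<lambda>bs. w * low ?d bs) = (\<lambda>_. 0)"
    by (simp only: koszul.simps pair_eq_zero_iff koszul_zero) simp
  then have "w * low ?d (replicate (length vs) False) = 0" by (rule fun_cong)
  then have "low ?d (replicate (length vs) False) = 0" by (rule w)
  then have "z = b (False # replicate (length vs) False)" by simp
  then show "z \<in> R" using b(1) by (auto simp: cochains_def)
qed

end

section \<open>The grading of monoid algebras\<close>

definition supported :: "'a set \<Rightarrow> ('a \<Rightarrow>\<^sub>0 'k::zero) set"
  where "supported P = {p. Poly_Mapping.keys p \<subseteq> P}"

abbreviation monomial :: "'a \<Rightarrow> 'a \<Rightarrow>\<^sub>0 'k::zero_neq_one"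
  where "monomial a \<equiv> Poly_Mapping.single a 1"

lemma unital_subring_supported:
  assumes "add_submonoid P"
  shows "unital_subring (supported P :: ('a::comm_monoid_add \<Rightarrow>\<^sub>0 'k::comm_ring_1) set)"
proof
  fix a b :: "'a \<Rightarrow>\<^sub>0 'k"
  show "1 \<in> supported P" using assms by (simp add: supported_def add_submonoid_def)
  assume a: "a \<in> supported P" "b \<in> supported P"
  have "Poly_Mapping.keys (a - b) \<subseteq> Poly_Mapping.keys a \<union> Poly_Mapping.keys b"
    by (auto simp: in_keys_iff lookup_minus)
  then show "a - b \<in> supported P" using a by (auto simp: supported_def)
  show "a * b \<in> supported P"
    using a keys_mult[of a b] assms unfolding supported_def add_submonoid_def by blast
qed

lemma monomial_supported: "a \<in> P \<Longrightarrow> monomial a \<in> supported P"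
  by (simp add: supported_def)

lemma lookup_monomial_mult:
  fixes a :: "'a::cancel_comm_monoid_add"
  shows "Poly_Mapping.lookup (monomial a * p) (a + u) = (Poly_Mapping.lookup p u :: 'k::comm_ring_1)"
  by (simp add: lookup_mult lookup_single when_mult)

definition homogeneous_part :: "'a \<Rightarrow> ('a \<Rightarrow>\<^sub>0 'k::zero) \<Rightarrow> 'a \<Rightarrow>\<^sub>0 'k"
  where "homogeneous_part u p = Poly_Mapping.single u (Poly_Mapping.lookup p u)"

lemma homogeneous_part_monomial_mult:
  fixes a :: "'a::cancel_comm_monoid_add"
  shows "homogeneous_part (a + u) (monomial a * p) = monomial a * homogeneous_part u (p :: _ \<Rightarrow>\<^sub>0 'k::comm_ring_1)"
  by (simp add: homogeneous_part_def lookup_monomial_mult mult_single)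

lemma homogeneous_part_diff:
  "homogeneous_part u (p - p') = homogeneous_part u p - homogeneous_part u (p' :: _ \<Rightarrow>\<^sub>0 'k::comm_ring_1)"
  by (simp add: homogeneous_part_def lookup_minus single_diff)

lemma homogeneous_part_idem [simp]: "homogeneous_part u (homogeneous_part u p) = homogeneous_part u p"
  by (simp add: homogeneous_part_def)

lemma homogeneous_part_zero [simp]: "homogeneous_part u 0 = 0"
  by (simp add: homogeneous_part_def)

lemma keys_homogeneous_part: "Poly_Mapping.keys (homogeneous_part u p) \<subseteq> {u} \<inter> Poly_Mapping.keys p"
  by (auto simp: homogeneous_part_def in_keys_iff lookup_single when_def split: if_splits)

lemma homogeneous_part_supported: "p \<in> supported P \<Longrightarrow> homogeneous_part u p \<in> supported P"
  using keys_homogeneous_part[of u p] by (auto simp: supported_def)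

lemma sum_homogeneous_parts:
  assumes "finite K" "Poly_Mapping.keys p \<subseteq> K"
  shows "(\<Sum>k\<in>K. homogeneous_part k p) = (p :: _ \<Rightarrow>\<^sub>0 'k::comm_monoid_add)"
proof (rule poly_mapping_eqI)
  fix k
  show "Poly_Mapping.lookup (\<Sum>k\<in>K. homogeneous_part k p) k = Poly_Mapping.lookup p k"
    using assms by (auto simp: lookup_sum homogeneous_part_def lookup_single when_def sum.delta in_keys_iff)
qed

primrec weight :: "'a::comm_monoid_add list \<Rightarrow> bool list \<Rightarrow> 'a"
  where
    "weight [] bs = 0"
  | "weight (a # as) bs =
      (case bs of [] \<Rightarrow> 0 | b # bs' \<Rightarrow> (if b then a else 0) + weight as bs')"

text \<open>
  For a sequence of monomials, a basis vector of the Koszul complex carries the total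
  exponent \<open>weight as bs\<close> of the monomials that occur in it. With coefficients of degree
  \<open>u + weight as bs\<close> the differential preserves the internal degree \<open>u\<close>.
\<close>

definition degree_part :: "'a::comm_monoid_add list \<Rightarrow> 'a \<Rightarrow> (bool list \<Rightarrow> 'a \<Rightarrow>\<^sub>0 'k::zero)
    \<Rightarrow> bool list \<Rightarrow> 'a \<Rightarrow>\<^sub>0 'k"
  where "degree_part as u c = (\<lambda>bs. homogeneous_part (u + weight as bs) (c bs))"

lemma koszul_degree_part:
  fixes c :: "bool list \<Rightarrow> 'a::cancel_comm_monoid_add \<Rightarrow>\<^sub>0 'k::comm_ring_1"
  shows "koszul (map monomial as) (degree_part as u c) = degree_part as u (koszul (map monomial as) c)"
proof (induction as arbitrary: u c)
  case Nil then show ?case by (simp add: degree_part_def)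
next
  case (Cons a as)
  have low: "low (degree_part (a # as) u c) = degree_part as u (low c)"
    and high: "high (degree_part (a # as) u c) = degree_part as (a + u) (high c)"
    for c :: "bool list \<Rightarrow> 'a \<Rightarrow>\<^sub>0 'k"
    by (auto simp: degree_part_def add_ac)
  have *: "degree_part (a # as) u c [] = 0" if "c [] = 0" for c :: "bool list \<Rightarrow> 'a \<Rightarrow>\<^sub>0 'k"
    using that by (simp add: degree_part_def)
  show ?case
  proof (rule cochain_eqI)
    show "low (koszul (map monomial (a # as)) (degree_part (a # as) u c)) =
        low (degree_part (a # as) u (koszul (map monomial (a # as)) c))"
      unfolding low by (simp add: low Cons)
    show "high (koszul (map monomial (a # as)) (degree_part (a # as) u c)) =
        high (degree_part (a # as) u (koszul (map monomial (a # as)) c))"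
      unfolding high
      by (simp add: high Cons fun_cong[OF low])
        (simp add: degree_part_def homogeneous_part_diff homogeneous_part_monomial_mult add.assoc)
  qed (simp add: *)
qed

lemma degree_part_cochain:
  "c \<in> cochains (supported P) n j \<Longrightarrow> degree_part as u c \<in> cochains (supported P) n j"
  by (auto simp: cochains_def degree_part_def homogeneous_part_supported)
    (metis homogeneous_part_zero)+

lemma degree_part_linear:
  fixes c :: "bool list \<Rightarrow> 'a::ab_group_add \<Rightarrow>\<^sub>0 'k::comm_ring_1"
  shows "degree_part as u (\<lambda>bs. monomial y * c bs - c' bs) =
    (\<lambda>bs. monomial y * degree_part as (u - y) c bs - degree_part as u c' bs)"
proof
  fix bs
  have "homogeneous_part (y + (u - y + weight as bs)) (monomial y * c bs) =
      monomial y * homogeneous_part (u - y + weight as bs) (c bs)"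
    by (rule homogeneous_part_monomial_mult)
  moreover have "y + (u - y + weight as bs) = u + weight as bs" by simp
  ultimately show "degree_part as u (\<lambda>bs. monomial y * c bs - c' bs) bs =
      monomial y * degree_part as (u - y) c bs - degree_part as u c' bs"
    by (simp add: degree_part_def homogeneous_part_diff)
qed

lemma cochain_sum_degree_parts:
  fixes c :: "bool list \<Rightarrow> 'a::ab_group_add \<Rightarrow>\<^sub>0 'k::comm_ring_1"
  assumes c: "c \<in> cochains R n j"
  obtains U where "finite U" "c = (\<lambda>bs. \<Sum>u\<in>U. degree_part as u c bs)"
proof
  let ?U = "\<Union>bs\<in>{bs. length bs = n}. (\<lambda>k. k - weight as bs) ` Poly_Mapping.keys (c bs)"
  have "finite {bs :: bool list. length bs = n}"
    using finite_lists_length_eq[of "UNIV :: bool set" n] by simp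
  then show fin: "finite ?U" by simp
  show "c = (\<lambda>bs. \<Sum>u\<in>?U. degree_part as u c bs)"
  proof
    fix bs
    show "c bs = (\<Sum>u\<in>?U. degree_part as u c bs)"
    proof (cases "length bs = n")
      case True
      have "(\<Sum>u\<in>?U. degree_part as u c bs) =
          (\<Sum>k\<in>(\<lambda>u. u + weight as bs) ` ?U. homogeneous_part k (c bs))"
        by (subst sum.reindex) (auto simp: inj_on_def degree_part_def)
      also have "\<dots> = c bs"
      proof (rule sum_homogeneous_parts)
        show "finite ((\<lambda>u. u + weight as bs) ` ?U)" using fin by blast
        show "Poly_Mapping.keys (c bs) \<subseteq> (\<lambda>u. u + weight as bs) ` ?U"
        proof
          fix k assume "k \<in> Poly_Mapping.keys (c bs)"
          then have "k - weight as bs \<in> ?U" using True by blast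
          then show "k \<in> (\<lambda>u. u + weight as bs) ` ?U"
            by (intro image_eqI[of _ _ "k - weight as bs"]) auto
        qed
      qed
      finally show ?thesis by simp
    next
      case False
      then have "c bs = 0" using c by (auto simp: cochains_def)
      then show ?thesis by (simp add: degree_part_def)
    qed
  qed
qed

text \<open>
  A graded form of Nakayama's lemma. A cocycle of internal degree \<open>u\<close> is, up to
  coboundaries, the product of the monomial of \<open>y\<close> with a cocycle of degree \<open>u - y\<close>. After
  \<open>n\<close> such divisions the degree is \<open>u - n y\<close>, and for large \<open>n\<close> no element of \<open>P\<close> is
  available as an exponent in this degree.
\<close>

lemma koszul_acyclic_below_drop_monomial:
  fixes y :: "int ^ 'n" and P :: "(int ^ 'n) set"
  assumes P: "add_submonoid P" and as: "set as \<subseteq> P" and y: "y \<in> P"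
    and unbounded: "\<And>u. \<exists>n. u - int n *s y \<notin> P"
    and V: "koszul_acyclic_below (supported P :: (_ \<Rightarrow>\<^sub>0 'k::comm_ring_1) set) (monomial y # map monomial as) t"
  shows "koszul_acyclic_below (supported P :: (_ \<Rightarrow>\<^sub>0 'k) set) (map monomial as) (t - 1)"
proof -
  let ?R = "supported P :: (_ \<Rightarrow>\<^sub>0 'k) set" and ?vs = "map monomial as :: (_ \<Rightarrow>\<^sub>0 'k) list"
  interpret unital_subring ?R using P by (rule unital_subring_supported)
  have y_add: "x + int n *s y \<in> P" if "x \<in> P" for x n
  proof (induction n)
    case (Suc n)
    have "x + int (Suc n) *s y = (x + int n *s y) + y"
      by (simp add: int_vec.scale_left_distrib algebra_simps)
    moreover have "(x + int n *s y) + y \<in> P"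
      using Suc y P unfolding add_submonoid_def by blast
    ultimately show ?case by (simp only:)
  qed (simp add: that)
  have vs: "set (monomial y # ?vs) \<subseteq> ?R" using as y by (auto simp: monomial_supported)
  \<comment> \<open>Here \<open>n\<close> is the number of divisions by the monomial of \<open>y\<close> after which no exponent is left.\<close>
  have hom: "\<exists>b\<in>cochains ?R (length as) (j - 1). koszul ?vs b = c"
    if "\<And>bs. length bs = length as \<Longrightarrow> u + weight as bs - int n *s y \<notin> P" "j < t - 1"
      "c \<in> cochains ?R (length as) j" "koszul ?vs c = (\<lambda>_. 0)" "degree_part as u c = c" for u n j c
    using that
  proof (induction n arbitrary: u c)
    case 0
    have "c bs = 0" for bs
    proof (rule ccontr)
      assume nz: "c bs \<noteq> 0"
      then have "length bs = length as" using 0 by (auto simp: cochains_def)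
      then have "u + weight as bs \<notin> P" using 0 by simp
      moreover have "Poly_Mapping.keys (c bs) \<subseteq> {u + weight as bs}"
        using fun_cong[OF "0.prems"(5), of bs] keys_homogeneous_part[of "u + weight as bs" "c bs"]
        by (auto simp: degree_part_def)
      moreover have "Poly_Mapping.keys (c bs) \<subseteq> P"
        using 0 by (auto simp: cochains_def supported_def)
      ultimately have "Poly_Mapping.keys (c bs) = {}" by blast
      then show False using nz by simp
    qed
    then have "koszul ?vs (\<lambda>_. 0) = c" by (simp add: fun_eq_iff)
    then show ?case using cochain_zero by blast
  next
    case (Suc n)
    have "c \<in> cochains ?R (length ?vs) j" using Suc.prems(3) by simp
    from cocycle_divisible_mod_coboundaries[OF V Suc.prems(2) vs this Suc.prems(4)]
    obtain c' b where c'0: "c' \<in> cochains ?R (length ?vs) j" "koszul ?vs c' = (\<lambda>_. 0)"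
      and b0: "b \<in> cochains ?R (length ?vs) (j - 1)"
      and eq: "c = (\<lambda>bs. monomial y * c' bs - koszul ?vs b bs)" .
    have c': "c' \<in> cochains ?R (length as) j" "koszul ?vs c' = (\<lambda>_. 0)"
      and b: "b \<in> cochains ?R (length as) (j - 1)"
      using c'0 b0 by simp_all
    let ?c = "degree_part as (u - y) c'" and ?b = "degree_part as u b"
    have "\<exists>b\<in>cochains ?R (length as) (j - 1). koszul ?vs b = ?c"
    proof (rule Suc.IH)
      show "u - y + weight as bs - int n *s y \<notin> P" if "length bs = length as" for bs
      proof -
        have "u - y + weight as bs - int n *s y = u + weight as bs - int (Suc n) *s y"
          by (simp add: int_vec.scale_left_distrib algebra_simps)
        then show ?thesis using Suc.prems(1)[OF that] by (simp only:) simp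
      qed
      show "?c \<in> cochains ?R (length as) j" by (rule degree_part_cochain[OF c'(1)])
      show "koszul ?vs ?c = (\<lambda>_. 0)"
        unfolding koszul_degree_part c' by (simp add: degree_part_def)
      show "degree_part as (u - y) ?c = ?c" by (simp add: degree_part_def)
    qed (fact Suc.prems(2))
    then obtain e where e: "e \<in> cochains ?R (length as) (j - 1)" "koszul ?vs e = ?c" by blast
    have "c = (\<lambda>bs. monomial y * ?c bs - degree_part as u (koszul ?vs b) bs)"
      using Suc.prems(5) eq degree_part_linear[of as u y c' "koszul ?vs b"] by simp
    also have "\<dots> = koszul ?vs (\<lambda>bs. monomial y * e bs - ?b bs)"
      by (simp add: koszul_linear e koszul_degree_part)
    finally have "koszul ?vs (\<lambda>bs. monomial y * e bs - ?b bs) = c" by simp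
    moreover have "(\<lambda>bs. monomial y * e bs - ?b bs) \<in> cochains ?R (length as) (j - 1)"
      using e(1) degree_part_cochain[OF b] monomial_supported[OF y]
      by (intro cochain_diff cochain_scale) auto
    ultimately show ?case by blast
  qed
  show ?thesis unfolding koszul_acyclic_below_def
  proof (intro allI impI ballI)
    fix j c assume j: "j < t - 1" and "c \<in> cochains ?R (length ?vs) j"
      and cyc: "koszul ?vs c = (\<lambda>_. 0)"
    then have c: "c \<in> cochains ?R (length as) j" by simp
    obtain U where U: "finite U" "c = (\<lambda>bs. \<Sum>u\<in>U. degree_part as u c bs)"
      using cochain_sum_degree_parts[OF c] .
    have "\<exists>b. b \<in> cochains ?R (length as) (j - 1) \<and> koszul ?vs b = degree_part as u c" for u
    proof -
      have "\<forall>bs. \<exists>m. u + weight as bs - int m *s y \<notin> P" by (rule allI, rule unbounded)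
      then obtain m where m: "\<And>bs. u + weight as bs - int (m bs) *s y \<notin> P"
        by (auto dest!: choice)
      let ?B = "{bs :: bool list. length bs = length as}"
      have fin: "finite ?B" using finite_lists_length_eq[of "UNIV :: bool set" "length as"] by simp
      \<comment> \<open>As \<open>P\<close> is closed under adding \<open>y\<close>, the largest of the bounds works for all basis vectors.\<close>
      define n where "n = Max (m ` ?B)"
      have n: "u + weight as bs - int n *s y \<notin> P" if "length bs = length as" for bs
      proof
        assume "u + weight as bs - int n *s y \<in> P"
        then have "u + weight as bs - int n *s y + int (n - m bs) *s y \<in> P" by (rule y_add)
        moreover have "m bs \<le> n" using that fin by (auto simp: n_def)
        ultimately show False using m[of bs]
          by (simp add: of_nat_diff int_vec.scale_left_diff_distrib algebra_simps)
      qed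
      have "koszul ?vs (degree_part as u c) = (\<lambda>_. 0)"
        unfolding koszul_degree_part cyc by (simp add: degree_part_def)
      moreover have "degree_part as u (degree_part as u c) = degree_part as u c"
        by (simp add: degree_part_def)
      ultimately show ?thesis using hom[OF n j degree_part_cochain[OF c]] by blast
    qed
    then obtain b where b: "\<And>u. b u \<in> cochains ?R (length as) (j - 1)"
      "\<And>u. koszul ?vs (b u) = degree_part as u c" by metis
    have "koszul ?vs (\<lambda>bs. \<Sum>u\<in>U. b u bs) = c"
      using U(2) by (simp add: koszul_sum b)
    moreover have "(\<lambda>bs. \<Sum>u\<in>U. b u bs) \<in> cochains ?R (length ?vs) (j - 1)"
      using b(1) by (simp add: cochain_sum)
    ultimately show "\<exists>b\<in>cochains ?R (length ?vs) (j - 1). koszul ?vs b = c" by blast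
  qed
qed

text \<open>
  Localization is exact: a cocycle over the larger ring can be multiplied into the smaller
  one by a single monomial, which is invertible in the larger ring.
\<close>

lemma koszul_acyclic_below_localize:
  fixes P P' :: "'a::ab_group_add set"
  assumes P': "add_submonoid P'" and "P \<subseteq> P'"
    and clear: "\<And>X. finite X \<Longrightarrow> X \<subseteq> P' \<Longrightarrow> \<exists>g. - g \<in> P' \<and> (\<forall>x\<in>X. g + x \<in> P)"
    and V: "koszul_acyclic_below (supported P :: (_ \<Rightarrow>\<^sub>0 'k::comm_ring_1) set) vs t"
  shows "koszul_acyclic_below (supported P' :: (_ \<Rightarrow>\<^sub>0 'k) set) vs t"
proof -
  interpret unital_subring "supported P' :: (_ \<Rightarrow>\<^sub>0 'k) set" using P' by (rule unital_subring_supported)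
  show ?thesis unfolding koszul_acyclic_below_def
  proof (intro allI impI ballI)
    fix j and c :: "bool list \<Rightarrow> 'a \<Rightarrow>\<^sub>0 'k"
    assume j: "j < t" and c: "c \<in> cochains (supported P') (length vs) j"
      and cyc: "koszul vs c = (\<lambda>_. 0)"
    let ?X = "\<Union>bs\<in>{bs. length bs = length vs}. Poly_Mapping.keys (c bs)"
    have "finite {bs :: bool list. length bs = length vs}"
      using finite_lists_length_eq[of "UNIV :: bool set" "length vs"] by simp
    then have "finite ?X" by simp
    moreover have "?X \<subseteq> P'" using c by (auto simp: cochains_def supported_def)
    ultimately obtain g where g: "- g \<in> P'" "\<And>x. x \<in> ?X \<Longrightarrow> g + x \<in> P" using clear by meson
    let ?c = "\<lambda>bs. monomial g * c bs"
    have "?c bs \<in> supported P" for bs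
    proof (cases "length bs = length vs")
      case True
      then show ?thesis using keys_mult[of "monomial g" "c bs"] g(2) by (fastforce simp: supported_def)
    next
      case False
      then have "c bs = 0" using c by (auto simp: cochains_def)
      then show ?thesis by (simp add: supported_def)
    qed
    then have "?c \<in> cochains (supported P) (length vs) j"
      using c by (auto simp: cochains_def) (metis mult_zero_right)+
    moreover have "koszul vs ?c = (\<lambda>_. 0)" by (simp add: koszul_scale cyc)
    ultimately obtain b where b: "b \<in> cochains (supported P) (length vs) (j - 1)" "koszul vs b = ?c"
      using V j unfolding koszul_acyclic_below_def by blast
    let ?b = "\<lambda>bs. monomial (- g) * b bs"
    have "b \<in> cochains (supported P') (length vs) (j - 1)"
      using b(1) \<open>P \<subseteq> P'\<close> by (auto simp: cochains_def supported_def)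
    then have "?b \<in> cochains (supported P') (length vs) (j - 1)"
      using g(1) by (intro cochain_scale monomial_supported)
    moreover have "koszul vs ?b = c"
      by (simp add: koszul_scale b mult.assoc[symmetric] mult_single)
    ultimately show "\<exists>b\<in>cochains (supported P') (length vs) (j - 1). koszul vs b = c" by blast
  qed
qed

text \<open>
  The sequence appears in reverse, as the Koszul complex grows at the head of the list and a
  regular sequence at its end.
\<close>

lemma koszul_acyclic_below_regular_sequence:
  fixes fs :: "('a::ab_group_add \<Rightarrow>\<^sub>0 'k::field) list"
  assumes Q: "add_submonoid Q" and reg: "regular_sequence (monoid_algebra Q) fs"
  shows "koszul_acyclic_below (supported Q) (rev fs) (int (length fs))"
proof -
  let ?R = "supported Q :: ('a \<Rightarrow>\<^sub>0 'k) set" and ?G = "monoid_algebra Q :: ('a \<Rightarrow>\<^sub>0 'k) ring"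
  interpret unital_subring ?R using Q by (rule unital_subring_supported)
  interpret G: cring ?G using Q by (rule cring_monoid_algebra)
  have G: "carrier ?G = ?R" "monoid.mult ?G = (*)" "add ?G = (+)" "\<zero>\<^bsub>?G\<^esub> = 0"
    by (simp_all add: monoid_algebra_def supported_def)
  have neg: "\<ominus>\<^bsub>?G\<^esub> x = - x" if "x \<in> ?R" for x
    by (rule G.minus_equality) (use that in \<open>auto simp: G uminus_closed\<close>)
  have fs: "set fs \<subseteq> ?R" using reg by (simp add: regular_sequence_def G)
  have "koszul_acyclic_below ?R (rev (take k fs)) (int k)" if "k \<le> length fs" for k
    using that
  proof (induction k)
    case 0 then show ?case by (simp add: koszul_acyclic_below_Nil)
  next
    case (Suc k)
    let ?vs = "rev (take k fs)" and ?I = "genideal ?G (set (take k fs))"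
    have k: "k < length fs" using Suc by simp
    have sub: "set (take k fs) \<subseteq> carrier ?G" using fs set_take_subset[of k fs] by (auto simp: G)
    interpret I: ideal ?I ?G by (rule G.genideal_ideal[OF sub])
    have len: "length ?vs = k" using k by simp
    have IR: "?I \<subseteq> ?R" using I.a_subset G by simp
    \<comment> \<open>As the elements homotopic to zero form an ideal, they include the ideal generated by the predecessors.\<close>
    have "ideal {x \<in> ?R. null_homotopic ?R ?vs x} ?G"
    proof (rule idealI[OF G.ring_axioms])
      show "subgroup {x \<in> ?R. null_homotopic ?R ?vs x} (add_monoid ?G)"
      proof (rule G.add.subgroupI)
        fix a assume "a \<in> {x \<in> ?R. null_homotopic ?R ?vs x}"
        then show "\<ominus>\<^bsub>?G\<^esub> a \<in> {x \<in> ?R. null_homotopic ?R ?vs x}"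
          using null_homotopic_mult[of ?vs a "- 1"] uminus_closed[OF one_closed]
          by (simp add: neg uminus_closed)
      qed (auto simp: G add_closed null_homotopic_add intro: zero_closed null_homotopic_zero)
    next
      fix a x assume "a \<in> {x \<in> ?R. null_homotopic ?R ?vs x}" "x \<in> carrier ?G"
      then have "x * a \<in> {x \<in> ?R. null_homotopic ?R ?vs x}"
        by (simp add: G mult_closed null_homotopic_mult)
      then show "x \<otimes>\<^bsub>?G\<^esub> a \<in> {x \<in> ?R. null_homotopic ?R ?vs x}"
        "a \<otimes>\<^bsub>?G\<^esub> x \<in> {x \<in> ?R. null_homotopic ?R ?vs x}"
        by (simp_all only: G mult.commute[of a x])
    qed
    moreover have "set (take k fs) \<subseteq> {x \<in> ?R. null_homotopic ?R ?vs x}"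
      using sub null_homotopic_member[of _ ?vs] by (auto simp: G)
    ultimately have null: "?I \<subseteq> {x \<in> ?R. null_homotopic ?R ?vs x}" by (rule G.genideal_minimal)
    have "koszul_acyclic_below ?R (fs ! k # ?vs) (int (length (fs ! k # ?vs)))"
    proof (rule koszul_acyclic_below_regular_Cons[where I = ?I])
      show "koszul_acyclic_below ?R ?vs (int (length ?vs))" using Suc len by simp
      show "set (fs ! k # ?vs) \<subseteq> ?R" using fs k sub by (auto simp: G)
      show "0 \<in> ?I" using I.zero_closed by (simp add: G)
      show "a - b \<in> ?I" if "a \<in> ?I" "b \<in> ?I" for a b
      proof -
        have "\<ominus>\<^bsub>?G\<^esub> b \<in> ?I" using that by simp
        then have "- b \<in> ?I" using neg[of b] that IR by (metis subsetD)
        then have "a + - b \<in> ?I" using I.a_closed[OF that(1)] by (simp only: G)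
        then show ?thesis by simp
      qed
      show "a * r \<in> ?I" if "r \<in> ?R" "a \<in> ?I" for r a
        using I.I_r_closed that by (simp add: G)
      show "set ?vs \<subseteq> ?I" using G.genideal_self[OF sub] by simp
      show "null_homotopic ?R ?vs x" if "x \<in> ?I" for x using null that by blast
      show "g \<in> ?I" if "g \<in> ?R" "fs ! k * g \<in> ?I" for g
        using reg k that by (simp add: regular_sequence_def G)
    qed
    then show ?case using k by (simp add: take_Suc_conv_app_nth)
  qed
  from this[of "length fs"] show ?thesis by simp
qed

section \<open>Finitely generated monoids and their faces\<close>

lemma strict_mono_incseq_subsequence:
  fixes k :: "nat \<Rightarrow> nat"
  obtains r :: "nat \<Rightarrow> nat" where "strict_mono r" "incseq (k \<circ> r)"
proof -
  obtain f where f: "strict_mono f" "monoseq (\<lambda>n. k (f n))" using seq_monosub[of k] by blast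
  show thesis
  proof (cases "incseq (\<lambda>n. k (f n))")
    case True
    then show ?thesis using that f by (simp add: comp_def)
  next
    case False
    then have dec: "decseq (\<lambda>n. k (f n))" using f(2) by (simp add: monoseq_iff)
    obtain N where N: "\<And>n. k (f N) \<le> k (f n)"
      using ex_has_least_nat[of "\<lambda>_. True" _ "\<lambda>n. k (f n)"] by auto
    have "k (f (N + n)) = k (f N)" for n
      using N[of "N + n"] decseqD[OF dec, of N "N + n"] by simp
    then have "incseq (k \<circ> (\<lambda>n. f (N + n)))" by (simp add: incseq_def)
    moreover have "strict_mono (\<lambda>n. f (N + n))" using f(1) by (simp add: strict_mono_def)
    ultimately show ?thesis using that by blast
  qed
qed

lemma add_submonoidI:
  "0 \<in> M \<Longrightarrow> (\<And>a b. a \<in> M \<Longrightarrow> b \<in> M \<Longrightarrow> a + b \<in> M) \<Longrightarrow> add_submonoid M"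
  by (simp add: add_submonoid_def)

lemma add_submonoid_scale:
  fixes x :: "int ^ 'n"
  assumes "add_submonoid M" "x \<in> M"
  shows "int n *s x \<in> M"
proof (induction n)
  case 0 then show ?case using assms by (simp add: add_submonoid_def)
next
  case (Suc n)
  have "int (Suc n) *s x = int n *s x + x" by (simp add: int_vec.scale_left_distrib)
  moreover have "int n *s x + x \<in> M"
    using Suc assms unfolding add_submonoid_def by blast
  ultimately show ?case by (simp only:)
qed

lemma add_submonoid_hull_insert:
  fixes s :: "int ^ 'n"
  assumes "x \<in> add_submonoid hull (insert s S)"
  shows "\<exists>n e. e \<in> add_submonoid hull S \<and> x = int n *s s + e"
  using assms
proof (rule hull_induct)
  have H: "add_submonoid (add_submonoid hull S)" by (rule add_submonoid_hull)
  then have H0: "0 \<in> add_submonoid hull S"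
    unfolding add_submonoid_def[of "add_submonoid hull S"] by blast
  show "\<exists>n e. e \<in> add_submonoid hull S \<and> x = int n *s s + e" if "x \<in> insert s S" for x
  proof (cases "x = s")
    case True then show ?thesis using H0 by (intro exI[of _ 1] exI[of _ 0]) simp
  next
    case False then show ?thesis using that hull_inc[of x S add_submonoid]
      by (intro exI[of _ 0] exI[of _ x]) simp
  qed
  show "add_submonoid {x. \<exists>n e. e \<in> add_submonoid hull S \<and> x = int n *s s + e}"
  proof (rule add_submonoidI, unfold mem_Collect_eq)
    show "\<exists>n e. e \<in> add_submonoid hull S \<and> 0 = int n *s s + e"
      using H0 by (intro exI[of _ 0] exI[of _ 0]) simp
    fix a b assume "\<exists>n e. e \<in> add_submonoid hull S \<and> a = int n *s s + e"
      "\<exists>n e. e \<in> add_submonoid hull S \<and> b = int n *s s + e"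
    then obtain n e m f where *: "e \<in> add_submonoid hull S" "a = int n *s s + e"
      "f \<in> add_submonoid hull S" "b = int m *s s + f" by blast
    have "e + f \<in> add_submonoid hull S"
      using H *(1,3) unfolding add_submonoid_def[of "add_submonoid hull S"] by blast
    then show "\<exists>n e. e \<in> add_submonoid hull S \<and> a + b = int n *s s + e"
      by (intro exI[of _ "n + m"] exI[of _ "e + f"]) (simp add: * int_vec.scale_left_distrib)
  qed
qed

text \<open>
  Dickson's lemma in the form needed below: in a finitely generated monoid, every sequence
  has a subsequence that increases with respect to divisibility.
\<close>

lemma dickson_subsequence:
  fixes f :: "nat \<Rightarrow> int ^ 'n"
  assumes "finite S" "\<And>n. f n \<in> add_submonoid hull S"
  obtains r :: "nat \<Rightarrow> nat" where "strict_mono r" "\<And>m n. m \<le> n \<Longrightarrow> f (r n) - f (r m) \<in> add_submonoid hull S"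
  using assms
proof (induction S arbitrary: f thesis rule: finite_induct)
  case empty
  have "add_submonoid hull {} = ({0} :: (int ^ 'n) set)"
    by (rule hull_unique) (auto simp: add_submonoid_def)
  then show ?case using empty by (intro empty(1)[of id]) (auto simp: strict_mono_def)
next
  case (insert s S)
  have "\<forall>n. \<exists>k e. e \<in> add_submonoid hull S \<and> f n = int k *s s + e"
    using insert.prems(2) add_submonoid_hull_insert by blast
  then obtain k e where ke: "\<And>n. e n \<in> add_submonoid hull S" "\<And>n. f n = int (k n) *s s + e n"
    by metis
  obtain r :: "nat \<Rightarrow> nat" where r: "strict_mono r" "\<And>m n. m \<le> n \<Longrightarrow> e (r n) - e (r m) \<in> add_submonoid hull S"
    using insert.IH[of e] ke(1) by blast
  obtain r' :: "nat \<Rightarrow> nat" where r': "strict_mono r'" "incseq ((k \<circ> r) \<circ> r')"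
    by (rule strict_mono_incseq_subsequence)
  show ?case
  proof (rule insert.prems(1)[of "r \<circ> r'"])
    show "strict_mono (r \<circ> r')" using r(1) r'(1) by (rule strict_mono_o)
    fix m n :: nat assume mn: "m \<le> n"
    let ?m = "r (r' m)" and ?n = "r (r' n)" and ?H = "add_submonoid hull (insert s S)"
    have H: "add_submonoid ?H" by (rule add_submonoid_hull)
    have "k ?m \<le> k ?n" using incseqD[OF r'(2) mn] by simp
    then have "f ?n - f ?m = int (k ?n - k ?m) *s s + (e ?n - e ?m)"
      by (simp add: ke(2) of_nat_diff int_vec.scale_left_diff_distrib algebra_simps)
    moreover have "int (k ?n - k ?m) *s s \<in> ?H"
      by (rule add_submonoid_scale[OF H]) (simp add: hull_inc)
    moreover have "r' m \<le> r' n" using r'(1) mn by (simp add: strict_mono_less_eq)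
    then have "e ?n - e ?m \<in> ?H"
      using r(2) hull_mono[of S "insert s S" add_submonoid] by blast
    ultimately show "f ((r \<circ> r') n) - f ((r \<circ> r') m) \<in> ?H"
      using H unfolding add_submonoid_def[of ?H] by simp
  qed
qed

text \<open>
  For a face \<open>F\<close> of \<open>Q\<close>, inverting the monomials with exponent in \<open>F\<close> turns \<open>\<K>[Q]\<close> into the
  algebra of this monoid.
\<close>

definition localization :: "'a::ab_group_add set \<Rightarrow> 'a set \<Rightarrow> 'a set"
  where "localization Q F = {q - f | q f. q \<in> Q \<and> f \<in> F}"

text \<open>
  The smallest face containing the face \<open>F\<close> and the element \<open>w\<close>: the divisors of the
  elements \<open>n w + f\<close>.
\<close>

definition face_span :: "(int ^ 'n) set \<Rightarrow> (int ^ 'n) set \<Rightarrow> int ^ 'n \<Rightarrow> (int ^ 'n) set"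
  where "face_span Q F w = {a \<in> Q. \<exists>b\<in>Q. \<exists>n. \<exists>f\<in>F. a + b = int n *s w + f}"

locale generated_monoid =
  fixes Q S :: "(int ^ 'n) set"
  assumes finite_generators: "finite S" and generated: "Q = add_submonoid hull S"
begin

lemma submonoid: "add_submonoid Q"
  unfolding generated by (rule add_submonoid_hull)

lemma zero_mem: "0 \<in> Q"
  and add_mem: "a \<in> Q \<Longrightarrow> b \<in> Q \<Longrightarrow> a + b \<in> Q"
  using submonoid by (auto simp: add_submonoid_def)

lemma generators_subset: "S \<subseteq> Q"
  unfolding generated by (rule hull_subset)

lemma face_subset: "monoid_face Q F \<Longrightarrow> F \<subseteq> Q"
  by (simp add: monoid_face_def)

lemma face_add_iff: "monoid_face Q F \<Longrightarrow> a \<in> Q \<Longrightarrow> b \<in> Q \<Longrightarrow> a + b \<in> F \<longleftrightarrow> a \<in> F \<and> b \<in> F"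
  unfolding monoid_face_def by blast

lemma face_submonoid:
  assumes F: "monoid_face Q F" shows "add_submonoid F"
proof -
  obtain f where "f \<in> F" using F by (auto simp: monoid_face_def)
  then have "0 \<in> F" using face_add_iff[OF F zero_mem, of f] face_subset[OF F] by auto
  then show ?thesis using face_add_iff[OF F] face_subset[OF F] unfolding add_submonoid_def by blast
qed

lemma face_zero: "monoid_face Q F \<Longrightarrow> 0 \<in> F"
  and face_add: "monoid_face Q F \<Longrightarrow> a \<in> F \<Longrightarrow> b \<in> F \<Longrightarrow> a + b \<in> F"
  using face_submonoid by (auto simp: add_submonoid_def)

lemma face_scaleD:
  assumes F: "monoid_face Q F" and "x \<in> Q" "n > 0" "int n *s x \<in> F"
  shows "x \<in> F"
proof -
  obtain m where "n = Suc m" using assms(3) by (cases n) auto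
  then have "x + int m *s x \<in> F"
    using assms(4) by (simp add: int_vec.scale_left_distrib)
  then show ?thesis
    using face_add_iff[OF F assms(2) add_submonoid_scale[OF submonoid assms(2)]] by simp
qed

lemma mem_group_closure_face:
  assumes F: "monoid_face Q F" and "x \<in> group_closure F"
  shows "\<exists>a\<in>F. \<exists>b\<in>F. x = a - b"
  using assms(2)
proof (induction rule: group_closure.induct)
  case (base s)
  then show ?case using face_zero[OF F] by (intro bexI[of _ s] bexI[of _ 0]) auto
next
  case (diff s t)
  then obtain a b c d where "a \<in> F" "b \<in> F" "c \<in> F" "d \<in> F" "s = a - b" "t = c - d" by blast
  then show ?case using face_add[OF F]
    by (intro bexI[of _ "a + d"] bexI[of _ "b + c"]) auto
qed

lemma face_eq_group_closure_Int:
  assumes F: "monoid_face Q F" shows "F = Q \<inter> group_closure F"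
proof
  show "F \<subseteq> Q \<inter> group_closure F" using face_subset[OF F] by (auto intro: group_closure.base)
  show "Q \<inter> group_closure F \<subseteq> F"
  proof
    fix x assume x: "x \<in> Q \<inter> group_closure F"
    then obtain a b where "a \<in> F" "b \<in> F" "x = a - b" using mem_group_closure_face[OF F] by blast
    then show "x \<in> F" using face_add_iff[OF F, of x b] x face_subset[OF F] by auto
  qed
qed

lemma whole_face: "monoid_face Q Q"
  unfolding monoid_face_def using zero_mem add_mem by auto

lemma mem_localization_if_mem: "monoid_face Q F \<Longrightarrow> q \<in> Q \<Longrightarrow> q \<in> localization Q F"
  unfolding localization_def using face_zero by (intro CollectI exI[of _ q] exI[of _ 0]) simp

lemma localization_submonoid:
  assumes F: "monoid_face Q F" shows "add_submonoid (localization Q F)"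
  unfolding add_submonoid_def
proof (intro conjI ballI)
  show "0 \<in> localization Q F" by (rule mem_localization_if_mem[OF F zero_mem])
  fix a b assume "a \<in> localization Q F" "b \<in> localization Q F"
  then obtain p f q g where "p \<in> Q" "f \<in> F" "q \<in> Q" "g \<in> F" "a = p - f" "b = q - g"
    unfolding localization_def by blast
  then show "a + b \<in> localization Q F"
    unfolding localization_def using add_mem face_add[OF F]
    by (intro CollectI exI[of _ "p + q"] exI[of _ "f + g"]) auto
qed

lemma localization_mono: "G \<subseteq> F \<Longrightarrow> localization Q G \<subseteq> localization Q F"
  unfolding localization_def by blast

lemma localization_minimal_face: "localization Q (minimal_face Q) = Q"
proof
  show "localization Q (minimal_face Q) \<subseteq> Q"
  proof
    fix x assume "x \<in> localization Q (minimal_face Q)"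
    then obtain q f where "q \<in> Q" "- f \<in> Q" "x = q - f"
      unfolding localization_def minimal_face_def by blast
    then show "x \<in> Q" using add_mem[of q "- f"] by simp
  qed
  show "Q \<subseteq> localization Q (minimal_face Q)"
    using mem_localization_if_mem[OF monoid_face_minimal_face[OF submonoid]] by blast
qed

lemma generator_divides:
  assumes F: "monoid_face Q F" and q: "q \<in> Q" "q \<notin> F"
  obtains s q' where "s \<in> S - F" "q' \<in> Q" "q = q' + s"
proof -
  have "q \<in> add_submonoid hull S" using q generated by simp
  then have "q \<in> Q \<and> (q \<in> F \<or> (\<exists>s\<in>S - F. \<exists>q'\<in>Q. q = q' + s))"
  proof (rule hull_induct)
    fix x assume "x \<in> S"
    then show "x \<in> Q \<and> (x \<in> F \<or> (\<exists>s\<in>S - F. \<exists>q'\<in>Q. x = q' + s))"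
      using generators_subset zero_mem by (metis DiffI add_0 subsetD)
  next
    let ?T = "{q. q \<in> Q \<and> (q \<in> F \<or> (\<exists>s\<in>S - F. \<exists>q'\<in>Q. q = q' + s))}"
    have 1: "a + b \<in> ?T" if ab: "a \<in> ?T" "b \<in> Q" "a \<notin> F" for a b
    proof -
      obtain s q' where "s \<in> S - F" "q' \<in> Q" "a = q' + s" using ab by blast
      moreover have "a + b = (q' + b) + s" using \<open>a = q' + s\<close> by simp
      ultimately show ?thesis using ab add_mem by blast
    qed
    show "add_submonoid ?T"
    proof (rule add_submonoidI)
      show "0 \<in> ?T" using zero_mem face_zero[OF F] by simp
      fix a b assume ab: "a \<in> ?T" "b \<in> ?T"
      show "a + b \<in> ?T"
      proof (cases "a \<in> F \<and> b \<in> F")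
        case True then show ?thesis using ab add_mem face_add[OF F] by simp
      next
        case False then show ?thesis using 1[of a b] 1[of b a] ab by (auto simp: add.commute)
      qed
    qed
  qed
  then show thesis using that q by blast
qed

lemma face_subset_hull:
  assumes F: "monoid_face Q F" shows "F \<subseteq> add_submonoid hull (S \<inter> F)"
proof
  fix x assume "x \<in> F"
  then have "x \<in> add_submonoid hull S" using face_subset[OF F] generated by auto
  then have "x \<in> Q \<and> (x \<in> F \<longrightarrow> x \<in> add_submonoid hull (S \<inter> F))"
  proof (rule hull_induct)
    fix x assume "x \<in> S"
    then show "x \<in> Q \<and> (x \<in> F \<longrightarrow> x \<in> add_submonoid hull (S \<inter> F))"
      using generators_subset by (auto intro: hull_inc)
  next
    show "add_submonoid {x. x \<in> Q \<and> (x \<in> F \<longrightarrow> x \<in> add_submonoid hull (S \<inter> F))}"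
      using zero_mem add_mem face_add_iff[OF F] add_submonoid_hull[of "S \<inter> F"]
        add_submonoid_def[of "add_submonoid hull (S \<inter> F)"]
      by (intro add_submonoidI) auto
  qed
  then show "x \<in> add_submonoid hull (S \<inter> F)" using \<open>x \<in> F\<close> by blast
qed

lemma face_subsetI:
  assumes F: "monoid_face Q F" and G: "monoid_face Q G" and "S \<inter> F \<subseteq> G"
  shows "F \<subseteq> G"
  using face_subset_hull[OF F] hull_minimal[of "S \<inter> F" G add_submonoid] assms(3)
    face_submonoid[OF G] by blast

text \<open>
  A face containing the sum of all generators in \<open>F\<close> contains each of them. So this sum
  serves as a point in the relative interior of \<open>F\<close>.
\<close>

lemma interior_element:
  assumes F: "monoid_face Q F"
  obtains f where "f \<in> F" "\<And>G. monoid_face Q G \<Longrightarrow> f \<in> G \<Longrightarrow> F \<subseteq> G"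
proof -
  have "\<exists>f\<in>F. \<forall>G. monoid_face Q G \<longrightarrow> f \<in> G \<longrightarrow> T \<subseteq> G" if "finite T" "T \<subseteq> F" for T
    using that
  proof (induction T rule: finite_induct)
    case empty then show ?case using face_zero[OF F] by blast
  next
    case (insert t T)
    then obtain f where f: "f \<in> F" "\<And>G. monoid_face Q G \<Longrightarrow> f \<in> G \<Longrightarrow> T \<subseteq> G" by auto
    show ?case
    proof (intro bexI[of _ "t + f"] allI impI)
      show "t + f \<in> F" using insert f face_add[OF F] by simp
      fix G assume "monoid_face Q G" "t + f \<in> G"
      then show "insert t T \<subseteq> G"
        using face_add_iff[of G t f] f insert face_subset[OF F] by auto
    qed
  qed
  from this[of "S \<inter> F"] show thesis using that face_subsetI[OF F] finite_generators by blast
qed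

text \<open>
  If \<open>u - n y = q\<^sub>n - f\<^sub>n\<close> held for all \<open>n\<close>, then along a subsequence both \<open>q\<^sub>n\<close> and \<open>f\<^sub>n\<close>
  would be increasing for divisibility. Comparing two members shows that a positive multiple
  of \<open>y\<close> divides an element of \<open>F\<close>, so that \<open>y \<in> F\<close>.
\<close>

lemma subtracting_leaves_localization:
  assumes F: "monoid_face Q F" and y: "y \<in> Q" "y \<notin> F"
  shows "\<exists>n. u - int n *s y \<notin> localization Q F"
proof (rule ccontr)
  assume "\<not> ?thesis"
  then have "\<forall>n. \<exists>p. fst p \<in> Q \<and> snd p \<in> F \<and> u - int n *s y = fst p - snd p"
    unfolding localization_def by fastforce
  from choice[OF this] obtain p where p:
    "\<And>n. fst (p n) \<in> Q" "\<And>n. snd (p n) \<in> F" "\<And>n. u - int n *s y = fst (p n) - snd (p n)"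
    by blast
  define q f where "q n = fst (p n)" and "f n = snd (p n)" for n
  have qf: "\<And>n. q n \<in> Q" "\<And>n. f n \<in> F" "\<And>n. u - int n *s y = q n - f n"
    unfolding q_def f_def by (fact p)+
  obtain r :: "nat \<Rightarrow> nat" where r: "strict_mono r" "\<And>m n. m \<le> n \<Longrightarrow> q (r n) - q (r m) \<in> Q"
    using dickson_subsequence[OF finite_generators, of q] qf(1) generated by blast
  have "f (r n) \<in> add_submonoid hull (S \<inter> F)" for n using qf(2) face_subset_hull[OF F] by blast
  then obtain r' :: "nat \<Rightarrow> nat" where r': "strict_mono r'"
    "\<And>m n. m \<le> n \<Longrightarrow> f (r (r' n)) - f (r (r' m)) \<in> add_submonoid hull (S \<inter> F)"
    using dickson_subsequence[of "S \<inter> F" "\<lambda>n. f (r n)"] finite_generators by blast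
  define m n where "m = r (r' 0)" and "n = r (r' 1)"
  have mn: "m < n" using r(1) r'(1) by (simp add: m_def n_def strict_mono_def)
  have fF: "f n - f m \<in> F"
    using r'(2)[of 0 1] hull_minimal[of "S \<inter> F" F add_submonoid, OF _ face_submonoid[OF F]]
    by (auto simp: m_def n_def)
  have qQ: "q n - q m \<in> Q"
    using r(2)[of "r' 0" "r' 1"] r'(1) by (simp add: m_def n_def strict_mono_less_eq)
  have "int (n - m) *s y = (u - int m *s y) - (u - int n *s y)"
    using mn by (simp add: of_nat_diff int_vec.scale_left_diff_distrib)
  also have "\<dots> = (f n - f m) - (q n - q m)" unfolding qf(3) by simp
  finally have "int (n - m) *s y + (q n - q m) = f n - f m" by simp
  then have nF: "int (n - m) *s y \<in> F"
    using face_add_iff[OF F add_submonoid_scale[OF submonoid y(1)] qQ, of "n - m"] fF by simp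
  have "n - m > 0" using mn by simp
  from face_scaleD[OF F y(1) this nF] y(2) show False by contradiction
qed

lemma face_span:
  assumes F: "monoid_face Q F" and w: "w \<in> Q"
  shows "monoid_face Q (face_span Q F w)" "F \<subseteq> face_span Q F w" "w \<in> face_span Q F w"
    "\<And>G. monoid_face Q G \<Longrightarrow> F \<subseteq> G \<Longrightarrow> w \<in> G \<Longrightarrow> face_span Q F w \<subseteq> G"
proof -
  show "F \<subseteq> face_span Q F w"
  proof
    fix f assume "f \<in> F"
    then show "f \<in> face_span Q F w" using zero_mem face_subset[OF F] unfolding face_span_def
      by (intro CollectI conjI bexI[of _ 0] exI[of _ 0] bexI[of _ f]) auto
  qed
  show "w \<in> face_span Q F w" using zero_mem w face_zero[OF F] unfolding face_span_def
    by (intro CollectI conjI bexI[of _ 0] exI[of _ 1] bexI[of _ 0]) auto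
  have down: "a \<in> face_span Q F w" if "a \<in> Q" "b \<in> Q" and ab: "a + b \<in> face_span Q F w" for a b
  proof -
    obtain c n f where "c \<in> Q" "f \<in> F" "a + b + c = int n *s w + f"
      using ab unfolding face_span_def by blast
    then show ?thesis using that add_mem[of b c] unfolding face_span_def
      by (intro CollectI conjI bexI[of _ "b + c"] exI[of _ n] bexI[of _ f]) (auto simp: add.assoc)
  qed
  have up: "a + b \<in> face_span Q F w" if ab: "a \<in> face_span Q F w" "b \<in> face_span Q F w" for a b
  proof -
    obtain c n f d m g where *: "a \<in> Q" "b \<in> Q" "c \<in> Q" "f \<in> F" "a + c = int n *s w + f"
      "d \<in> Q" "g \<in> F" "b + d = int m *s w + g"
      using ab unfolding face_span_def by blast
    have "(a + b) + (c + d) = (a + c) + (b + d)" by simp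
    also have "\<dots> = int (n + m) *s w + (f + g)"
      unfolding * by (simp add: int_vec.scale_left_distrib)
    finally show ?thesis using * add_mem face_add[OF F] unfolding face_span_def by blast
  qed
  have "face_span Q F w \<subseteq> Q" by (auto simp: face_span_def)
  then show "monoid_face Q (face_span Q F w)"
    unfolding monoid_face_def using down up \<open>w \<in> face_span Q F w\<close> by (metis add.commute empty_iff)
  fix G assume G: "monoid_face Q G" "F \<subseteq> G" "w \<in> G"
  show "face_span Q F w \<subseteq> G"
  proof
    fix a assume "a \<in> face_span Q F w"
    then obtain b n f where *: "a \<in> Q" "b \<in> Q" "f \<in> F" "a + b = int n *s w + f"
      unfolding face_span_def by blast
    have "int n *s w + f \<in> G"
      using G * add_submonoid_scale[OF face_submonoid[OF G(1)] G(3)] face_add[OF G(1)] by blast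
    then show "a \<in> G" using face_add_iff[OF G(1), of a b] * by simp
  qed
qed

end

section \<open>Ranks of faces\<close>

lemma common_denominator:
  fixes u :: "'b \<Rightarrow> rat"
  assumes "finite A"
  shows "\<exists>d::int. d \<noteq> 0 \<and> (\<forall>a\<in>A. \<exists>k::int. of_int d * u a = of_int k)"
  using assms
proof (induction A rule: finite_induct)
  case empty then show ?case by (intro exI[of _ 1]) simp
next
  case (insert x A)
  then obtain d :: int where d: "d \<noteq> 0" "\<And>a. a \<in> A \<Longrightarrow> \<exists>k::int. of_int d * u a = of_int k" by blast
  obtain p q :: int where pq: "quotient_of (u x) = (p, q)" by (cases "quotient_of (u x)")
  then have q: "q > 0" "u x = of_int p / of_int q"
    using quotient_of_denom_pos quotient_of_div by blast+
  have "\<exists>k::int. of_int (d * q) * u a = of_int k" if a: "a \<in> insert x A" for a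
  proof (cases "a = x")
    case True
    then show ?thesis using q by (intro exI[of _ "d * p"]) simp
  next
    case False
    then obtain k :: int where "of_int d * u a = of_int k" using d(2) a by blast
    moreover have "of_int (d * q) * u a = of_int q * (of_int d * u a)" by simp
    ultimately show ?thesis by (intro exI[of _ "q * k"]) simp
  qed
  then show ?case using d(1) q(1) by (intro exI[of _ "d * q"]) auto
qed

text \<open>
  Over the rationals the vectors stay independent, by clearing denominators. The bound
  ensures that the maximum in the definition of \<^const>\<open>group_rank\<close> exists.
\<close>

lemma int_independent_card_bound:
  fixes B :: "(int ^ 'n) set"
  assumes B: "finite B" "int_vec.independent B"
  shows "card B \<le> vec.dim (UNIV :: (rat ^ 'n) set)"
proof -
  let ?r = "\<lambda>x :: int ^ 'n. (\<chi> i. of_int (x $ i)) :: rat ^ 'n"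
  have inj: "inj ?r" by (auto simp: inj_def vec_eq_iff)
  have "\<not> vec.dependent (?r ` B)"
  proof
    assume "vec.dependent (?r ` B)"
    then obtain u where u: "\<exists>v\<in>?r ` B. u v \<noteq> 0" "(\<Sum>v\<in>?r ` B. u v *s v) = 0"
      using B(1) by (auto simp: vec.dependent_finite)
    obtain d :: int where d: "d \<noteq> 0" "\<And>b. b \<in> B \<Longrightarrow> \<exists>k::int. of_int d * u (?r b) = of_int k"
      using common_denominator[OF B(1), of "\<lambda>b. u (?r b)"] by blast
    then obtain k :: "int ^ 'n \<Rightarrow> int" where k: "\<And>b. b \<in> B \<Longrightarrow> of_int d * u (?r b) = of_int (k b)"
      by metis
    have "(\<Sum>b\<in>B. k b *s b) = 0"
    proof (rule vec_eq_iff[THEN iffD2], rule allI)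
      fix i
      have "rat_of_int ((\<Sum>b\<in>B. k b *s b) $ i) = (\<Sum>b\<in>B. of_int (k b) * of_int (b $ i))"
        by simp
      also have "\<dots> = of_int d * (\<Sum>b\<in>B. u (?r b) * of_int (b $ i))"
        unfolding sum_distrib_left by (rule sum.cong) (simp_all flip: k)
      also have "(\<Sum>b\<in>B. u (?r b) * of_int (b $ i)) = (\<Sum>b\<in>B. u (?r b) *s ?r b) $ i"
        by simp
      also have "(\<Sum>b\<in>B. u (?r b) *s ?r b) = (\<Sum>v\<in>?r ` B. u v *s v)"
        by (subst sum.reindex) (use inj in \<open>auto intro: inj_on_subset\<close>)
      finally have "rat_of_int ((\<Sum>b\<in>B. k b *s b) $ i) = 0"
        unfolding u(2) by (simp only: zero_index mult_zero_right)
      then show "(\<Sum>b\<in>B. k b *s b) $ i = 0 $ i" by (simp only: of_int_eq_0_iff zero_index)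
    qed
    then have "k b = 0" if "b \<in> B" for b
      using int_vec.independentD[OF B(2,1) subset_refl] that by blast
    then have "u (?r b) = 0" if "b \<in> B" for b using k[OF that] d(1) that by simp
    then show False using u(1) by auto
  qed
  then have "card (?r ` B) \<le> vec.dim (UNIV :: (rat ^ 'n) set)"
    by (intro vec.independent_card_le_dim) auto
  moreover have "card (?r ` B) = card B" using inj by (intro card_image) (auto intro: inj_on_subset)
  ultimately show ?thesis by simp
qed

lemma group_rank_attained:
  "\<exists>B. B \<subseteq> G \<and> finite B \<and> card B = group_rank G \<and> int_vec.independent B"
  unfolding group_rank_def
proof (rule GreatestI_nat[of "\<lambda>r. \<exists>B. B \<subseteq> G \<and> finite B \<and> card B = r \<and> int_vec.independent B" 0])
  show "\<exists>B. B \<subseteq> G \<and> finite B \<and> card B = 0 \<and> int_vec.independent B"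
    by (intro exI[of _ "{}"]) (simp add: int_vec.independent_empty)
qed (use int_independent_card_bound in auto)

lemma card_le_group_rank:
  "B \<subseteq> G \<Longrightarrow> finite B \<Longrightarrow> int_vec.independent B \<Longrightarrow> card B \<le> group_rank G"
  unfolding group_rank_def
  by (rule Greatest_le_nat[of "\<lambda>r. \<exists>B. B \<subseteq> G \<and> finite B \<and> card B = r \<and> int_vec.independent B"])
    (use int_independent_card_bound in auto)

lemma group_closure_scale:
  fixes x :: "int ^ 'n"
  assumes "x \<in> group_closure G" shows "k *s x \<in> group_closure G"
proof -
  have nat: "int n *s x \<in> group_closure G" for n
  proof (induction n)
    case (Suc n)
    have "int (Suc n) *s x = int n *s x + x" by (simp add: int_vec.scale_left_distrib)
    then show ?case using group_closure_add[OF Suc assms] by (simp only:)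
  qed simp
  show ?thesis
  proof (cases "k \<ge> 0")
    case True then show ?thesis using nat[of "nat k"] by simp
  next
    case False
    then have "- (k *s x) \<in> group_closure G" using nat[of "nat (- k)"] by simp
    then show ?thesis by simp
  qed
qed

lemma group_closure_sum: "(\<And>x. x \<in> A \<Longrightarrow> f x \<in> group_closure G) \<Longrightarrow> sum f A \<in> group_closure G"
  by (induction A rule: infinite_finite_induct) (auto intro: group_closure_add)

lemma group_closure_mono: "A \<subseteq> B \<Longrightarrow> group_closure A \<subseteq> group_closure B"
proof
  fix x assume "A \<subseteq> B" "x \<in> group_closure A"
  from this(2) show "x \<in> group_closure B"
    by (induction rule: group_closure.induct)
      (use \<open>A \<subseteq> B\<close> in \<open>auto intro: group_closure.intros\<close>)
qed

context generated_monoid begin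

text \<open>
  An element \<open>y\<close> of \<open>H\<close> outside \<open>G\<close> has no nonzero multiple in the group of \<open>G\<close>: its
  positive multiples would lie in \<open>G\<close>, hence \<open>y\<close> too. So \<open>y\<close> can be added to any independent
  subset of this group.
\<close>

lemma group_rank_face_less:
  assumes G: "monoid_face Q G" and H: "monoid_face Q H" and "G \<subset> H"
  shows "group_rank (group_closure G) < group_rank (group_closure H)"
proof -
  obtain y where y: "y \<in> H" "y \<notin> G" using assms(3) by blast
  then have yQ: "y \<in> Q" using face_subset[OF H] by blast
  obtain B where B: "B \<subseteq> group_closure G" "finite B" "card B = group_rank (group_closure G)"
    "int_vec.independent B" using group_rank_attained by blast
  have torsion: "k = 0" if "k *s y \<in> group_closure G" for k
  proof (rule ccontr)
    assume "k \<noteq> 0"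
    have "int (nat \<bar>k\<bar>) *s y \<in> group_closure G"
      using that by (cases "k \<ge> 0") auto
    moreover have "int (nat \<bar>k\<bar>) *s y \<in> Q" by (rule add_submonoid_scale[OF submonoid yQ])
    ultimately have "int (nat \<bar>k\<bar>) *s y \<in> G" using face_eq_group_closure_Int[OF G] by blast
    then show False using face_scaleD[OF G yQ, of "nat \<bar>k\<bar>"] y(2) \<open>k \<noteq> 0\<close> by simp
  qed
  have "y \<notin> B" using torsion[of 1] B(1) by auto
  have "int_vec.independent (insert y B)"
    unfolding int_vec.independent_explicit_module
  proof (intro allI impI)
    fix T u v assume T: "finite T" "T \<subseteq> insert y B" "(\<Sum>v\<in>T. u v *s v) = 0" "v \<in> T"
    have uy: "u y = 0" if "y \<in> T"
    proof (rule torsion)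
      have "u y *s y + (\<Sum>v\<in>T - {y}. u v *s v) = 0"
        using T(3) sum.remove[OF T(1) that, of "\<lambda>v. u v *s v"] by simp
      then have "u y *s y = - (\<Sum>v\<in>T - {y}. u v *s v)" by (simp add: eq_neg_iff_add_eq_0)
      moreover have "(\<Sum>v\<in>T - {y}. u v *s v) \<in> group_closure G"
        using T(2) B(1) by (intro group_closure_sum group_closure_scale) blast
      ultimately show "u y *s y \<in> group_closure G" by simp
    qed
    show "u v = 0"
    proof (cases "v = y")
      case False
      have "(\<Sum>v\<in>T - {y}. u v *s v) = 0"
      proof (cases "y \<in> T")
        case True
        then show ?thesis using T(3) sum.remove[OF T(1) True, of "\<lambda>v. u v *s v"] uy by simp
      qed (use T(3) in simp)
      then show ?thesis
        using int_vec.independentD[OF B(4), of "T - {y}" u v] T False by blast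
    qed (use uy T(4) in simp)
  qed
  moreover have "insert y B \<subseteq> group_closure H"
    using B(1) y(1) group_closure_mono[of G H] assms(3) by (auto intro: group_closure.base)
  ultimately have "card (insert y B) \<le> group_rank (group_closure H)"
    using B(2) by (intro card_le_group_rank) auto
  then show ?thesis using B \<open>y \<notin> B\<close> by simp
qed

lemma group_rank_face_mono:
  "monoid_face Q G \<Longrightarrow> monoid_face Q H \<Longrightarrow> G \<subseteq> H \<Longrightarrow>
    group_rank (group_closure G) \<le> group_rank (group_closure H)"
  using group_rank_face_less[of G H] by (metis less_imp_le order_refl psubsetI)

end

section \<open>The grade along chains of faces\<close>

lemma monomial_power: "(monomial x :: int ^ 'n \<Rightarrow>\<^sub>0 'k::comm_ring_1) ^ n = monomial (int n *s x)"
  by (induction n) (simp_all add: mult_single int_vec.scale_left_distrib)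

context generated_monoid begin

text \<open>
  The grade of the ideal \<open>\<pp>\<^sub>F\<close> of \<open>\<K>[Q - F]\<close>. Every enumeration of the generators outside
  \<open>F\<close> is admitted, which avoids choosing one.
\<close>

definition face_grade_ge :: "'k::field itself \<Rightarrow> (int ^ 'n) set \<Rightarrow> int \<Rightarrow> bool"
  where "face_grade_ge _ F t \<longleftrightarrow> (\<forall>as. set as = S - F \<longrightarrow>
    koszul_acyclic_below (supported (localization Q F) :: (int ^ 'n \<Rightarrow>\<^sub>0 'k) set) (map monomial as) t)"

lemma face_grade_ge_mono: "face_grade_ge K F t \<Longrightarrow> t' \<le> t \<Longrightarrow> face_grade_ge K F t'"
  by (auto simp: face_grade_ge_def koszul_acyclic_below_def)

text \<open>
  The faces spanned by \<open>G\<close> and any single element of \<open>H\<close> outside \<open>G\<close> all equal \<open>H\<close>. Hence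
  for such a \<open>w\<close>, the element \<open>y\<close> divides a multiple of \<open>w\<close> up to a unit of \<open>\<K>[Q - G]\<close>, and
  the generators of \<open>\<pp>\<^sub>G\<close> are nilpotent modulo \<open>y\<close> and the generators outside \<open>H\<close>. Then \<open>y\<close>
  is dropped at the cost of one degree.
\<close>

lemma face_grade_ge_cover:
  assumes G: "monoid_face Q G" and H: "monoid_face Q H" and GH: "G \<subset> H"
    and cover: "\<And>E. monoid_face Q E \<Longrightarrow> G \<subset> E \<Longrightarrow> E \<subseteq> H \<Longrightarrow> E = H"
    and grade: "face_grade_ge TYPE('k::field) G t"
  shows "face_grade_ge TYPE('k) H (t - 1)"
  unfolding face_grade_ge_def
proof (intro allI impI)
  fix as' assume as': "set as' = S - H"
  obtain as where as: "set as = S - G" using finite_list[of "S - G"] finite_generators by auto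
  obtain y where y: "y \<in> H" "y \<notin> G" using GH by blast
  have yQ: "y \<in> Q" using y face_subset[OF H] by blast
  let ?P = "localization Q G"
  let ?R = "supported ?P :: (int ^ 'n \<Rightarrow>\<^sub>0 'k) set"
  have P: "add_submonoid ?P" by (rule localization_submonoid[OF G])
  interpret unital_subring ?R by (rule unital_subring_supported[OF P])
  have QP: "Q \<subseteq> ?P" using mem_localization_if_mem[OF G] by blast
  have asP: "set as \<subseteq> ?P" "set as' \<subseteq> ?P" using as as' generators_subset QP by auto
  let ?ws = "monomial y # map monomial as' :: (int ^ 'n \<Rightarrow>\<^sub>0 'k) list"
  have ws: "set ?ws \<subseteq> ?R" using asP(2) yQ QP by (auto intro: monomial_supported)
  have "koszul_acyclic_below ?R (map monomial as) t"
    using grade as by (simp add: face_grade_ge_def)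
  then have "koszul_acyclic_below ?R ?ws t"
  proof (rule koszul_acyclic_below_radical)
    show "set (map monomial as) \<subseteq> ?R" using asP(1) by (auto intro: monomial_supported)
    fix v :: "int ^ 'n \<Rightarrow>\<^sub>0 'k" assume "v \<in> set (map monomial as)"
    then obtain w where w: "v = monomial w" "w \<in> S" "w \<notin> G" using as by auto
    have wQ: "w \<in> Q" using w generators_subset by blast
    show "\<exists>k. null_homotopic ?R ?ws (v ^ k)"
    proof (cases "w \<in> H")
      case False
      then have "v \<in> set ?ws" using w as' by auto
      then have "null_homotopic ?R ?ws (v ^ 1)" using null_homotopic_member ws by simp
      then show ?thesis by blast
    next
      case True
      \<comment> \<open>Consequently \<open>y\<close> divides some \<open>n w + f\<close> with \<open>f\<close> in \<open>G\<close>, and \<open>- f\<close> is available in \<open>Q - G\<close>.\<close>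
      have "face_span Q G w = H"
      proof (rule cover)
        show "monoid_face Q (face_span Q G w)" by (rule face_span(1)[OF G wQ])
        show "G \<subset> face_span Q G w" using face_span(2,3)[OF G wQ] w(3) by blast
        show "face_span Q G w \<subseteq> H" using face_span(4)[OF G wQ H] GH True by blast
      qed
      then obtain b n f where b: "b \<in> Q" "f \<in> G" "y + b = int n *s w + f"
        using y(1) unfolding face_span_def by blast
      have "monomial (b - f) \<in> ?R" using b(1,2) by (intro monomial_supported) (auto simp: localization_def)
      moreover have "null_homotopic ?R ?ws (monomial y)" using ws by (intro null_homotopic_member) auto
      ultimately have "null_homotopic ?R ?ws (monomial (b - f) * monomial y)"
        by (intro null_homotopic_mult)
      moreover have "int n *s w = (b - f) + y" using b(3) by (simp add: algebra_simps)
      then have "v ^ n = monomial (b - f) * monomial y"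
        unfolding w(1) monomial_power by (simp add: mult_single)
      ultimately show ?thesis by metis
    qed
  qed (rule ws)
  then have "koszul_acyclic_below ?R (map monomial as') (t - 1)"
    using koszul_acyclic_below_drop_monomial[OF P asP(2), of y t] yQ QP
      subtracting_leaves_localization[OF G yQ y(2)] by blast
  then show "koszul_acyclic_below (supported (localization Q H) :: (int ^ 'n \<Rightarrow>\<^sub>0 'k) set)
      (map monomial as') (t - 1)"
  proof (rule koszul_acyclic_below_localize[rotated 3])
    show "add_submonoid (localization Q H)" by (rule localization_submonoid[OF H])
    show "?P \<subseteq> localization Q H" using GH by (intro localization_mono) auto
    fix X assume "finite X" "X \<subseteq> localization Q H"
    \<comment> \<open>A common denominator of the elements of \<open>X\<close>, obtained by adding up their denominators.\<close>
    then have "\<exists>g\<in>H. \<forall>x\<in>X. g + x \<in> Q"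
    proof (induction X rule: finite_induct)
      case empty then show ?case using face_zero[OF H] by blast
    next
      case (insert x X)
      then obtain g where g: "g \<in> H" "\<forall>x\<in>X. g + x \<in> Q" by auto
      obtain q f where x: "q \<in> Q" "f \<in> H" "x = q - f"
        using insert.prems unfolding localization_def by blast
      have "(g + f) + x \<in> Q" using add_mem[of g q] x g(1) face_subset[OF H] by auto
      moreover have "(g + f) + x' \<in> Q" if "x' \<in> X" for x'
      proof -
        have "f + (g + x') \<in> Q" by (rule add_mem) (use that g x face_subset[OF H] in auto)
        then show ?thesis by (simp add: algebra_simps)
      qed
      ultimately show ?case using face_add[OF H g(1) x(2)] by blast
    qed
    then obtain g where g: "g \<in> H" "\<forall>x\<in>X. g + x \<in> Q" by blast
    have "0 - g \<in> localization Q H" using zero_mem g(1) unfolding localization_def by blast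
    then show "\<exists>g. - g \<in> localization Q H \<and> (\<forall>x\<in>X. g + x \<in> ?P)" using g(2) QP by auto
  qed
qed

text \<open>
  Among the faces strictly above \<open>G\<close> and inside \<open>F\<close>, one of least rank covers \<open>G\<close>, and each
  covering step costs one degree but raises the rank by at least one.
\<close>

lemma face_grade_ge_face:
  assumes G: "monoid_face Q G" and F: "monoid_face Q F" and "G \<subseteq> F"
    and "face_grade_ge TYPE('k::field) G t"
  shows "face_grade_ge TYPE('k) F
    (t - int (group_rank (group_closure F) - group_rank (group_closure G)))"
  using assms(1,3,4)
proof (induction "group_rank (group_closure F) - group_rank (group_closure G)"
    arbitrary: G t rule: less_induct)
  case less
  let ?r = "\<lambda>E. group_rank (group_closure E)"
  show ?case
  proof (cases "G = F")
    case True then show ?thesis using less by simp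
  next
    case False
    let ?P = "\<lambda>E. monoid_face Q E \<and> G \<subset> E \<and> E \<subseteq> F"
    have "?P F" using F less.prems False by blast
    from ex_has_least_nat[of ?P F ?r, OF this] obtain H
      where H: "monoid_face Q H" "G \<subset> H" "H \<subseteq> F" "\<And>E. ?P E \<Longrightarrow> ?r H \<le> ?r E" by blast
    have cover: "E = H" if "monoid_face Q E" "G \<subset> E" "E \<subseteq> H" for E
      using H(4)[of E] group_rank_face_less[OF that(1) H(1)] that H(3)
      by (metis leD order_trans psubsetI)
    have r: "?r G < ?r H" "?r H \<le> ?r F"
      using group_rank_face_less[OF less.prems(1) H(1,2)] group_rank_face_mono[OF H(1) F H(3)] by auto
    have "face_grade_ge TYPE('k) H (t - 1)"
      using face_grade_ge_cover[OF less.prems(1) H(1,2) cover less.prems(3)] by blast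
    with less.hyps[of H "t - 1"] r H(1,3)
    have "face_grade_ge TYPE('k) F (t - 1 - int (?r F - ?r H))" by simp
    then show ?thesis by (rule face_grade_ge_mono) (use r in simp)
  qed
qed

text \<open>
  Every element of \<open>\<mm>\<close> is a combination of the monomials of the noninvertible generators, so
  it acts by a map homotopic to zero on their Koszul complex.
\<close>

lemma face_grade_ge_regular_sequence:
  fixes fs :: "(int ^ 'n \<Rightarrow>\<^sub>0 'k::field) list"
  assumes reg: "regular_sequence (monoid_algebra Q) fs"
    and m: "set fs \<subseteq> graded_maximal_ideal Q"
  shows "face_grade_ge TYPE('k) (minimal_face Q) (int (length fs))"
  unfolding face_grade_ge_def localization_minimal_face
proof (intro allI impI)
  fix as assume as: "set as = S - minimal_face Q"
  have F0: "monoid_face Q (minimal_face Q)" by (rule monoid_face_minimal_face[OF submonoid])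
  let ?R = "supported Q :: (int ^ 'n \<Rightarrow>\<^sub>0 'k) set"
  interpret unital_subring ?R by (rule unital_subring_supported[OF submonoid])
  have ws: "set (map monomial as) \<subseteq> ?R" using as generators_subset by (auto intro: monomial_supported)
  show "koszul_acyclic_below ?R (map monomial as) (int (length fs))"
  proof (rule koszul_acyclic_below_radical)
    show "koszul_acyclic_below ?R (rev fs) (int (length fs))"
      by (rule koszul_acyclic_below_regular_sequence[OF submonoid reg])
    show "set (rev fs) \<subseteq> ?R" using m by (auto simp: graded_maximal_ideal_def supported_def)
    show "set (map monomial as) \<subseteq> ?R" by (rule ws)
    fix f assume "f \<in> set (rev fs)"
    then have keys: "Poly_Mapping.keys f \<subseteq> Q - minimal_face Q"
      using m by (auto simp: graded_maximal_ideal_def)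
    have "null_homotopic ?R (map monomial as) (\<Sum>k\<in>Poly_Mapping.keys f. homogeneous_part k f)"
    proof (rule null_homotopic_sum)
      fix k assume "k \<in> Poly_Mapping.keys f"
      then have "k \<in> Q" "k \<notin> minimal_face Q" using keys by auto
      from generator_divides[OF F0 this]
      obtain s q where s: "s \<in> S - minimal_face Q" "q \<in> Q" "k = q + s" .
      let ?c = "Poly_Mapping.single q (Poly_Mapping.lookup f k)"
      have "null_homotopic ?R (map monomial as) (monomial s)"
        using s(1) as ws by (intro null_homotopic_member) auto
      moreover have "?c \<in> ?R" using s(2) by (auto simp: supported_def)
      ultimately have "null_homotopic ?R (map monomial as) (?c * monomial s)"
        by (rule null_homotopic_mult)
      then show "null_homotopic ?R (map monomial as) (homogeneous_part k f)"
        by (simp add: homogeneous_part_def mult_single s(3))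
    qed
    then have "null_homotopic ?R (map monomial as) (f ^ 1)"
      by (simp add: sum_homogeneous_parts)
    then show "\<exists>k. null_homotopic ?R (map monomial as) (f ^ k)" by blast
  qed
qed

section \<open>The grade at the face of a family of holes\<close>

lemma normalization_add:
  assumes "x \<in> normalization Q" "q \<in> Q" shows "x + q \<in> normalization Q"
proof -
  have "real_vec (x + q) = real_vec x + real_vec q"
    by (simp add: real_vec_def vec_eq_iff)
  moreover have "real_vec q \<in> convex_cone hull (real_vec ` Q)" using assms(2) by (auto intro: hull_inc)
  ultimately show ?thesis
    using assms by (auto simp: normalization_def intro: convex_cone_hull_add group_closure_add group_closure.base)
qed

lemma subset_normalization: "Q \<subseteq> normalization Q"
  by (auto simp: normalization_def intro: hull_inc group_closure.base)

text \<open>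
  Suppose that \<open>p + n a\<close> never enters \<open>Q - F\<close>. Then all \<open>p + n (a + f)\<close> are holes, where \<open>f\<close>
  is in the relative interior of \<open>F\<close>. As the decomposition is finite, two of them lie in the
  same member \<open>c + \<int>G\<close> of it, so \<open>a + f \<in> G\<close>, and \<open>G\<close> contains both \<open>F\<close> and \<open>a\<close>. This member
  contains \<open>p + \<int>F\<close> properly and makes it redundant.
\<close>

lemma family_of_holes_representative:
  assumes F: "monoid_face Q F" and "family_of_holes Q (face_coset q F)"
  obtains p where "p \<in> group_closure Q" "p \<notin> localization Q F"
    "\<And>a. a \<in> Q \<Longrightarrow> a \<notin> F \<Longrightarrow> \<exists>n. p + int n *s a \<in> localization Q F"
proof -
  obtain D where D: "hole_decomposition Q D" "face_coset q F \<in> D"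
    using assms(2) unfolding family_of_holes_def by blast
  let ?N = "normalization Q"
  note dec = D(1)[unfolded hole_decomposition_def]
  note fin = dec[THEN conjunct1]
    and cosets = dec[THEN conjunct2, THEN conjunct1, THEN bspec]
    and cover = dec[THEN conjunct2, THEN conjunct2, THEN conjunct1]
    and irredundant = dec[THEN conjunct2, THEN conjunct2, THEN conjunct2, THEN bspec]
  obtain p F' where p: "p \<in> ?N" "monoid_face Q F'" "face_coset q F = face_coset p F'"
    using cosets[OF D(2)] by blast
  have diff_mem: "x - y \<in> group_closure E" if xy: "x \<in> face_coset a E" "y \<in> face_coset a E"
    for x y a :: "int ^ 'n" and E
  proof -
    obtain u v where "u \<in> group_closure E" "v \<in> group_closure E" "x = a + u" "y = a + v"
      using xy unfolding face_coset_def by blast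
    then show ?thesis using group_closure.diff[of u E v] by simp
  qed
  have coset_eq: "face_coset x E = face_coset a E" if x: "x \<in> face_coset a E" for x a :: "int ^ 'n" and E
  proof -
    obtain u where u: "u \<in> group_closure E" "x = a + u" using x unfolding face_coset_def by blast
    have "a + v \<in> face_coset x E" "x + v \<in> face_coset a E" if "v \<in> group_closure E" for v
    proof -
      show "a + v \<in> face_coset x E" unfolding face_coset_def u(2)
        by (rule image_eqI[of _ _ "v - u"]) (use that u(1) in \<open>auto intro: group_closure.diff\<close>)
      show "x + v \<in> face_coset a E" unfolding face_coset_def u(2)
        by (rule image_eqI[of _ _ "u + v"]) (use that u(1) in \<open>auto intro: group_closure_add\<close>)
    qed
    then show ?thesis by (auto simp: face_coset_def)
  qed
  have self: "a \<in> face_coset a E" for a :: "int ^ 'n" and E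
    unfolding face_coset_def by (rule image_eqI[of _ _ 0]) auto
  have "group_closure F = group_closure F'"
  proof -
    have "p + u \<in> face_coset q F" if "u \<in> group_closure F'" for u
      using that unfolding p(3) unfolding face_coset_def by blast
    then have "u \<in> group_closure F" if "u \<in> group_closure F'" for u
      using diff_mem[of "p + u" q F p] self[of p F'] that p(3) by simp
    moreover have "u \<in> group_closure F'" if u: "u \<in> group_closure F" for u
    proof -
      have "q + u \<in> face_coset q F" using u unfolding face_coset_def by blast
      then show ?thesis using diff_mem[of "q + u" p F' q] self[of q F] unfolding p(3) by simp
    qed
    ultimately show ?thesis by blast
  qed
  then have FF': "F = F'" using face_eq_group_closure_Int F p(2) by blast
  let ?H = "face_coset p F"
  have H: "?H \<in> D" using D(2) p(3) FF' by simp
  have hole: "x \<notin> Q" if "x \<in> ?H" for x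
    using cover H that subset_normalization by blast
  have "p \<notin> localization Q F"
  proof
    assume "p \<in> localization Q F"
    then obtain a f where "a \<in> Q" "f \<in> F" "p = a - f" unfolding localization_def by blast
    moreover from this have "a \<in> ?H" unfolding face_coset_def
      by (intro image_eqI[of _ _ f]) (auto intro: group_closure.base)
    ultimately show False using hole by blast
  qed
  moreover have "p \<in> group_closure Q" using p(1) by (simp add: normalization_def)
  moreover have "\<exists>n. p + int n *s a \<in> localization Q F" if a: "a \<in> Q" "a \<notin> F" for a
  proof (rule ccontr)
    assume never: "\<not> ?thesis"
    obtain f where f: "f \<in> F" "\<And>G. monoid_face Q G \<Longrightarrow> f \<in> G \<Longrightarrow> F \<subseteq> G"
      using interior_element[OF F] by blast
    have fQ: "f \<in> Q" using f face_subset[OF F] by blast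
    \<comment> \<open>Adding \<open>f\<close> forces the face of a member that contains two of these holes to contain all of \<open>F\<close>.\<close>
    define h where "h n = p + int n *s (a + f)" for n
    have "\<exists>H'\<in>D. h n \<in> H'" for n
    proof -
      have "h n \<notin> Q"
      proof
        assume "h n \<in> Q"
        then have "h n - int n *s f \<in> localization Q F"
          unfolding localization_def using add_submonoid_scale[OF face_submonoid[OF F] f(1)] by blast
        moreover have "h n - int n *s f = p + int n *s a"
          by (simp add: h_def int_vec.scale_right_distrib)
        ultimately show False using never by simp
      qed
      moreover have "h n \<in> ?N" unfolding h_def
        by (rule normalization_add[OF p(1) add_submonoid_scale[OF submonoid add_mem[OF a(1) fQ]]])
      ultimately show ?thesis using cover by blast
    qed
    then obtain E where E: "\<And>n. E n \<in> D" "\<And>n. h n \<in> E n" by metis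
    have "\<not> inj E" using finite_subset[OF _ fin, of "range E"] E(1) by (auto dest: finite_imageD)
    then obtain m n where mn: "E m = E n" "m < n"
      unfolding inj_def by (metis nat_neq_iff)
    obtain c G where G: "monoid_face Q G" "E n = face_coset c G" using cosets[OF E(1)] by blast
    have "h n - h m \<in> group_closure G" using diff_mem[of "h n" c G "h m"] E(2) mn(1) G(2) by metis
    moreover have "h n - h m = int (n - m) *s (a + f)"
      using mn(2) by (simp add: h_def of_nat_diff int_vec.scale_left_diff_distrib)
    ultimately have "int (n - m) *s (a + f) \<in> G"
      using face_eq_group_closure_Int[OF G(1)] add_submonoid_scale[OF submonoid add_mem[OF a(1) fQ]]
      by auto
    then have af: "a + f \<in> G"
      using face_scaleD[OF G(1) add_mem[OF a(1) fQ], of "n - m"] mn(2) by simp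
    then have aG: "a \<in> G" and FG: "F \<subseteq> G" using face_add_iff[OF G(1) a(1) fQ] f(2)[OF G(1)] by auto
    have "p \<in> E n"
    proof -
      have "int n *s (a + f) \<in> group_closure G"
        using af by (intro group_closure_scale group_closure.base) simp
      then have "- (int n *s (a + f)) \<in> group_closure G" by (simp only: group_closure_minus_iff)
      then have "h n + - (int n *s (a + f)) \<in> face_coset (h n) G" unfolding face_coset_def by blast
      then show ?thesis using coset_eq[of "h n" c G] E(2)[of n] G(2) by (simp add: h_def)
    qed
    then have pG: "E n = face_coset p G" using coset_eq G(2) by metis
    have "?H \<subseteq> E n" unfolding pG face_coset_def using group_closure_mono[OF FG] by blast
    moreover have "E n \<noteq> ?H"
    proof
      assume "E n = ?H"
      then have "p + a \<in> ?H" using aG pG unfolding face_coset_def by (auto intro: group_closure.base)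
      then have "(p + a) - p \<in> group_closure F" using self by (rule diff_mem)
      then show False using a face_eq_group_closure_Int[OF F] by auto
    qed
    ultimately have "(\<Union>H'\<in>D - {?H}. H' \<inter> ?N) = ?N - Q"
      using cover E(1)[of n] by blast
    then show False using irredundant[OF H] by contradiction
  qed
  ultimately show thesis using that by blast
qed

text \<open>
  Going through the list, the largest multiple of each \<open>a\<close> that keeps the translate outside
  \<open>P\<close> is added; memberships in \<open>P\<close> obtained before persist.
\<close>

lemma socle_translate:
  assumes P: "add_submonoid P" and "Q \<subseteq> P" "p \<notin> P"
    and "set as \<subseteq> Q" "\<And>a. a \<in> set as \<Longrightarrow> \<exists>n. p + int n *s a \<in> P"
  shows "\<exists>z. z \<notin> P \<and> z - p \<in> Q \<and> (\<forall>a\<in>set as. z + a \<in> P)"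
  using assms(4,5)
proof (induction as)
  case Nil then show ?case using assms(3) zero_mem by (intro exI[of _ p]) simp
next
  case (Cons a as)
  then obtain z where z: "z \<notin> P" "z - p \<in> Q" "\<And>a. a \<in> set as \<Longrightarrow> z + a \<in> P" by auto
  have Padd: "x + y \<in> P" if "x \<in> P" "y \<in> Q" for x y
    using P that assms(2) unfolding add_submonoid_def by blast
  obtain n where "p + int n *s a \<in> P" using Cons.prems by auto
  then have "(p + int n *s a) + (z - p) \<in> P" using z(2) by (rule Padd)
  then have n: "z + int n *s a \<in> P" by (simp add: algebra_simps)
  define m where "m = (LEAST n. z + int n *s a \<in> P)"
  have m: "z + int m *s a \<in> P" unfolding m_def by (rule LeastI[of "\<lambda>n. z + int n *s a \<in> P", OF n])
  then obtain l where l: "m = Suc l" using z(1) by (cases m) auto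
  then have notP: "z + int l *s a \<notin> P" using not_less_Least[of l "\<lambda>n. z + int n *s a \<in> P"] by (simp add: m_def)
  have la: "int l *s a \<in> Q" using Cons.prems by (intro add_submonoid_scale[OF submonoid]) auto
  have "(z + int l *s a) + a = z + int m *s a"
    unfolding l by (simp add: int_vec.scale_left_distrib algebra_simps)
  then have "(z + int l *s a) + a \<in> P" using m by (simp only:)
  moreover have "(z + int l *s a) + b \<in> P" if "b \<in> set as" for b
    using Padd[OF z(3)[OF that] la] by (simp add: algebra_simps)
  moreover have "(z + int l *s a) - p \<in> Q"
    using add_mem[OF z(2) la] by (simp add: algebra_simps)
  ultimately show ?case using notP by (intro exI[of _ "z + int l *s a"]) auto
qed

text \<open>
  The monomial of the translate \<open>z\<close> is multiplied into \<open>\<K>[Q - F]\<close> by all generators of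
  \<open>\<pp>\<^sub>F\<close>, but does not belong to it. If there are no such generators, then \<open>F = Q\<close> and
  \<open>Q - F\<close> is a group containing the normalization, so it has no holes.
\<close>

lemma not_face_grade_ge_2:
  assumes F: "monoid_face Q F" and holes: "family_of_holes Q (face_coset q F)"
  shows "\<not> face_grade_ge TYPE('k::field) F 2"
proof
  assume grade: "face_grade_ge TYPE('k) F 2"
  let ?P = "localization Q F"
  let ?R = "supported ?P :: (int ^ 'n \<Rightarrow>\<^sub>0 'k) set"
  obtain p where p: "p \<in> group_closure Q" "p \<notin> ?P"
    "\<And>a. a \<in> Q \<Longrightarrow> a \<notin> F \<Longrightarrow> \<exists>n. p + int n *s a \<in> ?P"
    using family_of_holes_representative[OF F holes] by blast
  have P: "add_submonoid ?P" by (rule localization_submonoid[OF F])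
  interpret unital_subring ?R by (rule unital_subring_supported[OF P])
  have QP: "Q \<subseteq> ?P" using mem_localization_if_mem[OF F] by blast
  obtain as where as: "set as = S - F" using finite_list[of "S - F"] finite_generators by auto
  have asQ: "set as \<subseteq> Q" using as generators_subset by blast
  obtain z where z: "z \<notin> ?P" "\<forall>a\<in>set as. z + a \<in> ?P"
    using socle_translate[OF P QP p(2) asQ] p(3) as asQ by blast
  show False
  proof (cases as)
    case Nil
    then have "Q \<subseteq> F" using as by (intro face_subsetI[OF whole_face F]) auto
    moreover obtain a b where "a \<in> Q" "b \<in> Q" "p = a - b"
      using mem_group_closure_face[OF whole_face p(1)] by blast
    ultimately show False using p(2) unfolding localization_def by blast
  next
    case (Cons w ws)
    have "koszul_acyclic_below ?R (map monomial as) 2"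
      using grade as unfolding face_grade_ge_def by blast
    then have V: "koszul_acyclic_below ?R (monomial w # map monomial ws) 2" using Cons by simp
    have "monomial z \<in> ?R"
    proof (rule mem_if_multiples_mem[OF V])
      show "set (monomial w # map monomial ws) \<subseteq> ?R"
        using asQ QP Cons by (auto intro!: monomial_supported)
      show "v * monomial z \<in> ?R" if "v \<in> set (monomial w # map monomial ws)" for v :: "int ^ 'n \<Rightarrow>\<^sub>0 'k"
        using that z(2) Cons by (auto simp: mult_single add.commute intro!: monomial_supported)
      show "x = 0" if "monomial w * x = 0" for x :: "int ^ 'n \<Rightarrow>\<^sub>0 'k"
      proof -
        have "x = monomial (- w) * (monomial w * x)" by (simp add: mult_single flip: mult.assoc)
        then show ?thesis using that by simp
      qed
    qed
    then show False using z(1) by (simp add: supported_def)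
  qed
qed

end

theorem theorem5p4:
  fixes Q F :: "(int ^ 'n) set" and q :: "int ^ 'n" and i :: nat
  assumes "affine_monoid Q"
    and "monoid_face Q F"
    and "family_of_holes Q (face_coset q F)"
    and "star_dim Q F = i"
  shows "star_depth TYPE('k::field) Q \<le> enat (i + 1)"
proof -
  obtain S where "finite S" "Q = add_submonoid hull S"
    using assms(1) unfolding affine_monoid_def by blast
  then interpret generated_monoid Q S by unfold_locales
  have F0: "monoid_face Q (minimal_face Q)" by (rule monoid_face_minimal_face[OF submonoid])
  have "length fs \<le> i + 1"
    if fs: "regular_sequence (monoid_algebra Q) fs" "set fs \<subseteq> graded_maximal_ideal Q"
    for fs :: "(int ^ 'n \<Rightarrow>\<^sub>0 'k) list"
  proof (rule ccontr)
    assume "\<not> ?thesis"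
    then have long: "2 \<le> int (length fs) - int i" by simp
    have "face_grade_ge TYPE('k) F (int (length fs) - int i)"
      using face_grade_ge_face[OF F0 assms(2) minimal_face_subset[OF submonoid assms(2)]
          face_grade_ge_regular_sequence[OF fs]] assms(4) by (simp add: star_dim_def)
    then have "face_grade_ge TYPE('k) F 2" using long by (rule face_grade_ge_mono)
    then show False using not_face_grade_ge_2[OF assms(2,3)] by contradiction
  qed
  then show ?thesis unfolding star_depth_def by (intro SUP_least) auto
qed

end
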